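(* Let $\psi:\mathbb R\to\mathbb R$ be a non-decreasing function such that $-\log(1-x+x^2/2)\leq \psi(x)\leq \log(1+x+x^2/2)$ for all $x\in\mathbb R$. Let $Y_1,\ldots,Y_n\in \mathbb C^{d\times d}$ be independent self-adjoint random matrices with finite second moments of entries, let $\sigma_n^2\geq \| \sum_{j=1}^n \mathbb EY_j^2 \|$ with $\sigma_n>0$, and let $\overline{\mathbb EY}:=\frac1n\sum_{j=1}^n\mathbb EY_j$. Let $0<t_{\min}<t_{\max}$, $t_j = 2^j t_{\min}$, $\mathcal J=\{ j\in\mathbb Z: t_{\min}< t_j < 2t_{\max} \}$, and for $j\in\mathcal J$ let $\theta_j=\sqrt{\frac{2 t_j}{n}}\frac{\sqrt n}{\sigma_n}$ and $T_{n,j}=\frac{1}{n\theta_j}\sum_{i=1}^n \psi(\theta_j Y_i)$. Let \[ j_\ast:=\min\Big\{ j\in \mathcal J: \forall k\in \mathcal J \text{ with } k>j,\ \| T_{n,k} - T_{n,j} \|\leq 2\frac{\sigma_n}{\sqrt n}\sqrt{\tfrac{2 t_k}{n}} \Big\} \] and $T_n^\ast:=T_{n,j_\ast}$. Then for any $t$ with $t_{\min}\leq t\leq t_{\max}$, \[ \Pr\Big(\big\| T_n^\ast - \overline{\mathbb EY} \big\|\geq 6\frac{\sigma_n}{\sqrt n}\sqrt{\frac{t}{n}} \Big) \leq 2d \frac{e^{-t}}{1 - e^{-t}}. \]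
   Context: $\|\cdot\|$ is the operator norm. For a real function $f$ and a self-adjoint matrix $A=U\,\mathrm{diag}(\lambda_i)\,U^\ast$, $f(A):=U\,\mathrm{diag}(f(\lambda_i))\,U^\ast$. Expectations are entrywise. *)

theory Defs
  imports "HOL-Probability.Probability"
begin

definition cnj_transpose :: "complex^'d^'d \<Rightarrow> complex^'d^'d" where
  "cnj_transpose A = (\<chi> i j. cnj (A $ j $ i))"

definition self_adjoint :: "complex^'d^'d \<Rightarrow> bool" where
  "self_adjoint A \<longleftrightarrow> cnj_transpose A = A"

definition unitary_mat :: "complex^'d^'d \<Rightarrow> bool" where
  "unitary_mat U \<longleftrightarrow> U ** cnj_transpose U = mat 1 \<and> cnj_transpose U ** U = mat 1"

definition real_diag :: "('d::finite \<Rightarrow> real) \<Rightarrow> complex^'d^'d" where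
  "real_diag l = (\<chi> i j. if i = j then complex_of_real (l i) else 0)"

definition mat_fun :: "(real \<Rightarrow> real) \<Rightarrow> complex^'d^'d \<Rightarrow> complex^'d^'d" where
  "mat_fun f A = (let (U, l) = (SOME (U, l). unitary_mat U \<and> A = U ** real_diag l ** cnj_transpose U)
                  in U ** real_diag (f \<circ> l) ** cnj_transpose U)"

definition op_norm :: "complex^'d^'d \<Rightarrow> real" where
  "op_norm A = onorm (\<lambda>x. A *v x)"

definition mat_expectation :: "'a measure \<Rightarrow> ('a \<Rightarrow> complex^'d^'d) \<Rightarrow> complex^'d^'d" where
  "mat_expectation M X = (\<chi> a b. integral\<^sup>L M (\<lambda>\<omega>. X \<omega> $ a $ b))"

end

theory Submission
  imports Defs
begin

text \<open>
  Write $\theta$ for a scale $\theta_j$. Since $\pm\psi(\pm\theta x) \le \log(1 \pm \theta x + \theta^2 x^2/2)$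
  and $A \mapsto \mathrm{tr}\,e^A$ is monotone, the deviations of $T_{n,j}$ are governed by the trace
  exponentials of $\sum_i \log(1 \pm \theta Y_i + \theta^2 Y_i^2/2) \mp \theta \sum_i \mathbb{E} Y_i$.
  By Lieb's concavity theorem the expectation may be moved inside the logarithms one summand at a
  time, and $\log(1 + W) \le W$ bounds the result by
  $\mathrm{tr}\exp(\frac{\theta^2}{2} \sum_i \mathbb{E} Y_i^2) \le d\, e^{\theta^2\sigma_n^2/2}$. With the chosen
  $\theta_j$, Markov's inequality shows that $T_{n,j}$ misses the mean by
  $\frac{\sigma_n}{\sqrt n}\sqrt{2 t_j/n}$ with probability at most $2d e^{-t_j}$.

  Let $m$ be such that $t \le t_m \le 2t$. Outside the failure events of all $j \ge m$ the index
  $m$ is admissible in the definition of $j_\ast$, so $j_\ast \le m$ and the error of $T_n^\ast$ is below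
  $3\frac{\sigma_n}{\sqrt n}\sqrt{2t_m/n}$; the failure probabilities sum to a geometric series
  because $t_j \ge (j - m + 1)t$.

  Lieb's theorem follows from the joint convexity of the quantum relative entropy, which is
  immediate from the formula
  $x \log\frac{x}{a} - x + a = \int_0^1 \frac{u (a - x)^2}{ua + (1-u)x}\,du$,
  since the integrand is a supremum of linear forms also when $x$ and $a$ act on a matrix from
  the left and from the right.
\<close>

section \<open>Hermitian matrices and their spectral decomposition\<close>

lemma adj_adj [simp]: "cnj_transpose (cnj_transpose A) = A"
  by (simp add: cnj_transpose_def vec_eq_iff)

lemma adj_mult: "cnj_transpose (A ** B) = cnj_transpose B ** cnj_transpose A"
  by (simp add: cnj_transpose_def vec_eq_iff matrix_matrix_mult_def mult.commute)

lemma adj_add: "cnj_transpose (A + B) = cnj_transpose A + cnj_transpose B"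
  by (simp add: cnj_transpose_def vec_eq_iff)

lemma adj_diff: "cnj_transpose (A - B) = cnj_transpose A - cnj_transpose B"
  by (simp add: cnj_transpose_def vec_eq_iff)

lemma adj_scaleR: "cnj_transpose (c *\<^sub>R A) = c *\<^sub>R cnj_transpose A"
  by (simp add: cnj_transpose_def vec_eq_iff)

lemma adj_real_diag [simp]: "cnj_transpose (real_diag l) = real_diag l"
  by (simp add: cnj_transpose_def real_diag_def vec_eq_iff)

lemma self_adjoint_add: "self_adjoint A \<Longrightarrow> self_adjoint B \<Longrightarrow> self_adjoint (A + B)"
  and self_adjoint_diff: "self_adjoint A \<Longrightarrow> self_adjoint B \<Longrightarrow> self_adjoint (A - B)"
  and self_adjoint_scaleR: "self_adjoint A \<Longrightarrow> self_adjoint (c *\<^sub>R A)"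
  by (simp_all add: self_adjoint_def adj_add adj_diff adj_scaleR)

lemma self_adjoint_0 [simp]: "self_adjoint 0"
  by (simp add: self_adjoint_def cnj_transpose_def vec_eq_iff)

lemma self_adjoint_mat_1: "self_adjoint (mat 1)"
  by (simp add: self_adjoint_def cnj_transpose_def mat_def vec_eq_iff)

lemma self_adjoint_sum: "(\<And>i. i \<in> I \<Longrightarrow> self_adjoint (A i)) \<Longrightarrow> self_adjoint (\<Sum>i\<in>I. A i)"
  by (induction I rule: infinite_finite_induct) (auto intro: self_adjoint_add)

lemma self_adjoint_square: "self_adjoint A \<Longrightarrow> self_adjoint (A ** A)"
  by (simp add: self_adjoint_def adj_mult)

lemma matrix_mult_scaleR_left: "(c *\<^sub>R A) ** B = c *\<^sub>R (A ** (B :: complex^'d^'d))"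
  and matrix_mult_scaleR_right: "A ** (c *\<^sub>R B) = c *\<^sub>R (A ** (B :: complex^'d^'d))"
  by (simp_all add: matrix_matrix_mult_def vec_eq_iff scaleR_sum_right)

lemma matrix_mult_add_left: "(A + A') ** B = A ** B + A' ** (B :: complex^'d^'d)"
  by (simp add: matrix_matrix_mult_def vec_eq_iff sum.distrib ring_distribs)

lemma matrix_mult_diff_left: "(A - A') ** B = A ** B - A' ** (B :: complex^'d^'d)"
  and matrix_mult_diff_right: "A ** (B - B') = A ** B - A ** (B' :: complex^'d^'d)"
  by (simp_all add: matrix_matrix_mult_def vec_eq_iff sum_subtractf ring_distribs)

text \<open>The form is conjugate-linear in its first argument. Its real part is the library's
  \<open>inner\<close>, which suffices for norms and quadratic forms; orthogonality of eigenvectors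
  over the complex numbers needs the full value.\<close>

definition cinner :: "complex^'d \<Rightarrow> complex^'d \<Rightarrow> complex" where
  "cinner x y = (\<Sum>i\<in>UNIV. cnj (x $ i) * y $ i)"

lemma cinner_self: "cinner x x = complex_of_real ((norm x)\<^sup>2)"
  by (simp add: cinner_def norm_vec_def L2_set_def sum_nonneg complex_norm_square mult.commute
      del: of_real_power)

lemma cinner_commute: "cinner x y = cnj (cinner y x)"
  by (simp add: cinner_def mult.commute)

lemma cinner_adj: "cinner x (A *v y) = cinner (cnj_transpose A *v x) y"
proof -
  have "cinner x (A *v y) = (\<Sum>i\<in>UNIV. \<Sum>j\<in>UNIV. cnj (x$i) * (A$i$j * y$j))"
    by (simp add: cinner_def matrix_vector_mult_def sum_distrib_left)
  also have "\<dots> = (\<Sum>j\<in>UNIV. \<Sum>i\<in>UNIV. cnj (x$i) * (A$i$j * y$j))"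
    by (rule sum.swap)
  also have "\<dots> = cinner (cnj_transpose A *v x) y"
    by (simp add: cinner_def matrix_vector_mult_def sum_distrib_right cnj_transpose_def)
       (simp add: mult_ac)
  finally show ?thesis .
qed

lemma inner_eq_Re_cinner: "x \<bullet> y = Re (cinner x y)"
  by (simp add: cinner_def inner_vec_def inner_complex_def)

lemma inner_adj: "x \<bullet> (A *v y) = (cnj_transpose A *v x) \<bullet> y"
  by (simp add: inner_eq_Re_cinner cinner_adj)

lemma matrix_vector_mult_scaleR_complex: "A *v (c *\<^sub>R x) = c *\<^sub>R (A *v x)"
  for A :: "complex^'d^'d"
  by (simp add: matrix_vector_mult_def vec_eq_iff scaleR_sum_right)

lemma linear_matrix_vector_mult_complex: "linear ((*v) (A :: complex^'d^'d))"
  by (rule linearI) (simp_all add: matrix_vector_right_distrib matrix_vector_mult_scaleR_complex)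

lemma continuous_on_matrix_vector_mult_complex:
  "continuous_on S ((*v) (A :: complex^'d^'d))"
  using linear_matrix_vector_mult_complex linear_continuous_on linear_conv_bounded_linear by blast

text \<open>A maximiser of the Rayleigh quotient is an eigenvector.\<close>
lemma eigenvector_in_invariant_subspace:
  fixes A :: "complex^'d^'d"
  assumes A: "self_adjoint A" and V: "subspace V" and inv: "\<And>x. x \<in> V \<Longrightarrow> A *v x \<in> V"
    and x: "x \<in> V" "x \<noteq> 0"
  obtains v l where "v \<in> V" "norm v = 1" "A *v v = l *\<^sub>R v"
proof -
  let ?S = "V \<inter> sphere 0 1"
  have "compact ?S"
    using closed_subspace[OF V] by (simp add: closed_Int_compact)
  moreover have "(1 / norm x) *\<^sub>R x \<in> ?S"
    using x V by (auto simp: subspace_def)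
  hence "?S \<noteq> {}" by blast
  moreover have "continuous_on ?S (\<lambda>x. x \<bullet> (A *v x))"
    by (intro continuous_intros continuous_on_matrix_vector_mult_complex)
  ultimately obtain v where v: "v \<in> ?S" and max: "\<And>y. y \<in> ?S \<Longrightarrow> y \<bullet> (A *v y) \<le> v \<bullet> (A *v v)"
    using continuous_attains_sup[of ?S "\<lambda>x. x \<bullet> (A *v x)"] by blast
  define l where "l = v \<bullet> (A *v v)"
  have vV: "v \<in> V" and nv: "norm v = 1"
    using v by auto
  hence vv: "v \<bullet> v = 1" by (simp add: dot_square_norm)
  have le: "y \<bullet> (A *v y) \<le> l * (y \<bullet> y)" if "y \<in> V" for y
  proof (cases "y = 0")
    case False
    have "(1 / norm y) *\<^sub>R y \<in> ?S"
      using that False V by (auto simp: subspace_def)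
    from max[OF this] have "(y \<bullet> (A *v y)) / (norm y)\<^sup>2 \<le> l"
      by (simp add: matrix_vector_mult_scaleR_complex l_def power2_eq_square)
    thus ?thesis using False by (simp add: power2_norm_eq_inner divide_simps)
  qed auto
  \<comment> \<open>This is the residual of the eigenvector equation. Moving from \<open>v\<close>
    by \<open>e\<close> in the direction \<open>w\<close> stays in \<open>V\<close>, and the
    first-order term of the Rayleigh inequality is then a multiple of
    \<open>w \<bullet> w\<close>.\<close>
  define w where "w = A *v v - l *\<^sub>R v"
  have wV: "w \<in> V"
    using vV inv V by (simp add: w_def subspace_diff subspace_scale)
  have sym: "v \<bullet> (A *v w) = w \<bullet> (A *v v)"
    using inner_adj[of v A w] A by (simp add: self_adjoint_def inner_commute)
  have ineq: "0 \<le> e\<^sup>2 * (l * (w \<bullet> w) - w \<bullet> (A *v w)) - 2 * e * (w \<bullet> w)" for e :: real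
  proof -
    have "v + e *\<^sub>R w \<in> V" using vV wV V by (simp add: subspace_add subspace_scale)
    from le[OF this] have "0 \<le> e\<^sup>2 * (l * (w \<bullet> w) - w \<bullet> (A *v w)) - 2 * e * (w \<bullet> (A *v v) - l * (w \<bullet> v))"
      by (simp add: matrix_vector_right_distrib matrix_vector_mult_scaleR_complex inner_add_left
          inner_add_right vv sym l_def[symmetric] inner_commute[of v w] algebra_simps power2_eq_square)
    moreover have "w \<bullet> (A *v v) - l * (w \<bullet> v) = w \<bullet> w"
      by (simp add: w_def inner_diff_right)
    ultimately show ?thesis by simp
  qed
  have "w \<bullet> w = 0"
  proof (rule ccontr)
    assume "w \<bullet> w \<noteq> 0"
    hence pos: "w \<bullet> w > 0" by simp
    define c where "c = \<bar>l * (w \<bullet> w) - w \<bullet> (A *v w)\<bar> + 1"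
    \<comment> \<open>With this step length the quadratic term recovers at most half of the linear
      loss \<open>2 * e * (w \<bullet> w)\<close>, so the right-hand side of \<open>ineq\<close> is
      negative.\<close>
    define e where "e = (w \<bullet> w) / c"
    have c: "c > 0" by (simp add: c_def)
    have e: "e > 0" using pos c by (simp add: e_def)
    have "0 \<le> e\<^sup>2 * (l * (w \<bullet> w) - w \<bullet> (A *v w)) - 2 * e * (w \<bullet> w)" by (rule ineq)
    also have "\<dots> \<le> e\<^sup>2 * c - 2 * e * (w \<bullet> w)"
      by (intro diff_right_mono mult_left_mono) (auto simp: c_def)
    also have "\<dots> = - e * (w \<bullet> w)"
      using c by (simp add: e_def power2_eq_square)
    finally show False using mult_pos_pos[OF e pos] by simp
  qed
  hence "A *v v = l *\<^sub>R v" by (simp add: w_def)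
  with vV nv show ?thesis using that by blast
qed

lemma linear_cinner: "linear (cinner x)"
  by (rule linearI) (simp_all add: cinner_def sum.distrib ring_distribs scaleR_sum_right)

text \<open>Induction on the index set: the orthogonal complement of the eigenvectors found so far
  is invariant because \<open>A\<close> is self-adjoint, so it contains a further eigenvector.
  Indexing by the matrix index type itself makes the case \<open>UNIV\<close> a full basis.\<close>

lemma orthonormal_eigenvectors:
  fixes A :: "complex^'d^'d" and I :: "'d set"
  assumes A: "self_adjoint A"
  shows "finite I \<Longrightarrow> \<exists>u l. (\<forall>i\<in>I. A *v u i = l i *\<^sub>R u i) \<and>
           (\<forall>i\<in>I. \<forall>j\<in>I. cinner (u i) (u j) = (if i = j then 1 else 0))"
proof (induction I rule: finite_induct)
  case (insert k I)
  then obtain u l where u: "\<And>i. i \<in> I \<Longrightarrow> A *v u i = l i *\<^sub>R u i"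
    "\<And>i j. i \<in> I \<Longrightarrow> j \<in> I \<Longrightarrow> cinner (u i) (u j) = (if i = j then 1 else 0)"
    by blast
  let ?V = "{x. \<forall>i\<in>I. cinner (u i) x = 0}"
  have V: "subspace ?V"
    by (auto simp: subspace_def linear_0[OF linear_cinner] linear_add[OF linear_cinner]
        linear_scale[OF linear_cinner])
  \<comment> \<open>Coordinate \<open>k\<close> of \<open>F x\<close> is always zero, so
    \<open>F\<close> is not surjective, hence not injective. A nonzero kernel vector is orthogonal
    to all eigenvectors found so far.\<close>
  define F :: "complex^'d \<Rightarrow> complex^'d" where "F x = (\<chi> i. if i \<in> I then cinner (u i) x else 0)" for x
  have F: "linear F"
    by (rule linearI) (simp_all add: F_def vec_eq_iff linear_add[OF linear_cinner] linear_scale[OF linear_cinner])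
  have "F x \<noteq> axis k 1" for x
    using insert.hyps by (auto simp: F_def vec_eq_iff axis_def intro!: exI[of _ k])
  hence "\<not> surj F" by (metis surjD)
  hence "\<not> inj F" using linear_injective_imp_surjective[OF F] by blast
  then obtain x where x: "F x = 0" "x \<noteq> 0"
    using F linear_injective_0 by blast
  hence xV: "x \<in> ?V" by (auto simp: F_def vec_eq_iff) (metis (full_types))
  have inv: "A *v y \<in> ?V" if "y \<in> ?V" for y
  proof -
    have "cinner (u i) (A *v y) = 0" if "i \<in> I" for i
    proof -
      have "cinner (u i) (A *v y) = cinner (l i *\<^sub>R u i) y"
        using A u(1)[OF that] by (simp add: cinner_adj self_adjoint_def)
      also have "\<dots> = l i *\<^sub>R cinner (u i) y"
        by (simp add: cinner_def scaleR_sum_right)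
      also have "cinner (u i) y = 0" using \<open>y \<in> ?V\<close> that by simp
      finally show ?thesis by simp
    qed
    thus ?thesis by simp
  qed
  obtain v \<mu> where v: "v \<in> ?V" "norm v = 1" "A *v v = \<mu> *\<^sub>R v"
    using eigenvector_in_invariant_subspace[OF A V inv xV x(2)] by blast
  have vu: "cinner (u i) v = 0" "cinner v (u i) = 0" if "i \<in> I" for i
    using v(1) that by (auto simp: cinner_commute[of v])
  have vv: "cinner v v = 1" using v(2) by (simp add: cinner_self)
  show ?case
    by (rule exI[of _ "u(k := v)"], rule exI[of _ "l(k := \<mu>)"])
       (use u v(3) vu vv insert.hyps in auto)
qed auto

lemma self_adjoint_spectral:
  fixes A :: "complex^'d^'d"
  assumes A: "self_adjoint A"
  obtains U l where "unitary_mat U" "A = U ** real_diag l ** cnj_transpose U"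
proof -
  obtain u :: "'d \<Rightarrow> complex^'d" and l where u: "\<And>i. A *v u i = l i *\<^sub>R u i"
    and orth: "\<And>i j. cinner (u i) (u j) = (if i = j then 1 else 0)"
    using orthonormal_eigenvectors[OF A, of UNIV] by auto
  define U :: "complex^'d^'d" where "U = (\<chi> a i. u i $ a)"
  have 1: "cnj_transpose U ** U = mat 1"
    using orth by (simp add: U_def cnj_transpose_def matrix_matrix_mult_def mat_def cinner_def vec_eq_iff)
  hence 2: "U ** cnj_transpose U = mat 1"
    using matrix_left_right_inverse by blast
  have "(A ** U) $ a $ i = (U ** real_diag l) $ a $ i" for a i
  proof -
    have "(A ** U) $ a $ i = (A *v u i) $ a"
      by (simp add: matrix_matrix_mult_def matrix_vector_mult_def U_def)
    also have "\<dots> = (U ** real_diag l) $ a $ i"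
      unfolding u by (simp add: matrix_matrix_mult_def real_diag_def U_def if_distrib
          cong: if_cong) (simp add: scaleR_conv_of_real)
    finally show ?thesis .
  qed
  hence "A ** U = U ** real_diag l" by (simp add: vec_eq_iff)
  hence "A ** U ** cnj_transpose U = U ** real_diag l ** cnj_transpose U" by simp
  hence "A = U ** real_diag l ** cnj_transpose U"
    by (simp add: matrix_mul_assoc[symmetric] 2)
  with 1 2 that show ?thesis by (auto simp: unitary_mat_def)
qed

section \<open>The functional calculus\<close>

lemma matrix_mult_real_diag: "(A ** real_diag l) $ i $ j = A $ i $ j * of_real (l j)"
  and real_diag_mult_matrix: "(real_diag l ** A) $ i $ j = of_real (l i) * A $ i $ j"
  by (simp_all add: matrix_matrix_mult_def real_diag_def if_distrib[of "\<lambda>x. _ * x"]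
      if_distrib[of "\<lambda>x. x * _"] cong: if_cong)

text \<open>\<open>mat_fun\<close> picks some diagonalisation by choice, and the result must not
  depend on it. The transition matrix \<open>?R\<close> intertwines the two diagonal matrices, so
  its entry at \<open>i\<close>, \<open>j\<close> vanishes unless \<open>l j = e i\<close>; hence it
  also intertwines their images under \<open>f\<close>.\<close>

lemma mat_fun_eq:
  fixes U :: "complex^'d^'d"
  assumes U: "unitary_mat U"
  shows "mat_fun f (U ** real_diag l ** cnj_transpose U) = U ** real_diag (f \<circ> l) ** cnj_transpose U"
proof -
  let ?A = "U ** real_diag l ** cnj_transpose U"
  let ?P = "\<lambda>(V, e). unitary_mat V \<and> ?A = V ** real_diag e ** cnj_transpose V"
  obtain V e where Ve: "Eps ?P = (V, e)" by fastforce
  have "?P (U, l)" using U by simp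
  hence "?P (Eps ?P)" by (rule someI)
  hence V: "unitary_mat V" "?A = V ** real_diag e ** cnj_transpose V"
    unfolding Ve by auto
  let ?R = "cnj_transpose V ** U"
  have "cnj_transpose V ** ?A ** U = cnj_transpose V ** (V ** real_diag e ** cnj_transpose V) ** U"
    using V(2) by simp
  hence "?R ** real_diag l ** (cnj_transpose U ** U) = (cnj_transpose V ** V) ** real_diag e ** ?R"
    by (simp add: matrix_mul_assoc)
  hence R: "?R ** real_diag l = real_diag e ** ?R"
    using U V(1) by (simp add: unitary_mat_def)
  have "(?R ** real_diag (f \<circ> l)) $ i $ j = (real_diag (f \<circ> e) ** ?R) $ i $ j" for i j
  proof -
    have "?R $ i $ j * of_real (l j) = of_real (e i) * ?R $ i $ j"
      using R by (metis matrix_mult_real_diag real_diag_mult_matrix)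
    hence "?R $ i $ j = 0 \<or> l j = e i" by (metis mult.commute mult_cancel_left of_real_eq_iff)
    thus ?thesis by (auto simp: matrix_mult_real_diag real_diag_mult_matrix)
  qed
  hence R': "?R ** real_diag (f \<circ> l) = real_diag (f \<circ> e) ** ?R" by (simp add: vec_eq_iff)
  have "U ** real_diag (f \<circ> l) ** cnj_transpose U = (V ** cnj_transpose V) ** U ** real_diag (f \<circ> l) ** cnj_transpose U"
    using V(1) by (simp add: unitary_mat_def)
  also have "\<dots> = V ** (?R ** real_diag (f \<circ> l)) ** cnj_transpose U"
    by (simp add: matrix_mul_assoc)
  also have "\<dots> = V ** real_diag (f \<circ> e) ** cnj_transpose V ** (U ** cnj_transpose U)"
    by (simp only: R' matrix_mul_assoc)
  also have "\<dots> = V ** real_diag (f \<circ> e) ** cnj_transpose V"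
    using U by (simp add: unitary_mat_def)
  finally show ?thesis
    unfolding mat_fun_def Let_def Ve by simp
qed

lemma self_adjoint_conj: "self_adjoint (U ** real_diag l ** cnj_transpose U)"
  by (simp add: self_adjoint_def adj_mult matrix_mul_assoc)

lemma self_adjoint_mat_fun [simp]:
  assumes "self_adjoint A"
  shows "self_adjoint (mat_fun f A)"
  using assms by (elim self_adjoint_spectral) (simp add: mat_fun_eq self_adjoint_conj)

lemma mat_fun_comp: "self_adjoint A \<Longrightarrow> mat_fun f (mat_fun g A) = mat_fun (f \<circ> g) A"
  by (elim self_adjoint_spectral) (simp add: mat_fun_eq comp_assoc)

lemma mat_fun_id: "self_adjoint A \<Longrightarrow> mat_fun (\<lambda>x. x) A = A"
  by (elim self_adjoint_spectral) (simp add: mat_fun_eq comp_def)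

lemma mat_fun_const: 
  assumes "self_adjoint A"
  shows "mat_fun (\<lambda>x. c) A = c *\<^sub>R mat 1"
proof -
  obtain U l where U: "unitary_mat U" "A = U ** real_diag l ** cnj_transpose U"
    using assms by (rule self_adjoint_spectral)
  have "real_diag (\<lambda>_::'a. c) = c *\<^sub>R mat 1"
    by (simp add: real_diag_def mat_def vec_eq_iff)
       (simp add: scaleR_conv_of_real)
  thus ?thesis using U
    by (simp add: mat_fun_eq comp_def matrix_mult_scaleR_left matrix_mult_scaleR_right unitary_mat_def)
qed

lemma mat_fun_add:
  assumes "self_adjoint A"
  shows "mat_fun (\<lambda>x. f x + g x) A = mat_fun f A + mat_fun g A"
proof -
  obtain U l where U: "unitary_mat U" "A = U ** real_diag l ** cnj_transpose U"
    using assms by (rule self_adjoint_spectral)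
  have "real_diag (\<lambda>x. f (l x) + g (l x)) = real_diag (\<lambda>x. f (l x)) + real_diag (\<lambda>x. g (l x))"
    by (simp add: real_diag_def vec_eq_iff)
  thus ?thesis using U
    by (simp add: mat_fun_eq comp_def matrix_add_ldistrib matrix_mult_add_left)
qed

lemma mat_fun_mult:
  assumes "self_adjoint A"
  shows "mat_fun (\<lambda>x. f x * g x) A = mat_fun f A ** mat_fun g A"
proof -
  obtain U l where U: "unitary_mat U" "A = U ** real_diag l ** cnj_transpose U"
    using assms by (rule self_adjoint_spectral)
  have d: "real_diag (\<lambda>x. f (l x) * g (l x)) = real_diag (\<lambda>x. f (l x)) ** real_diag (\<lambda>x. g (l x))"
    by (simp add: vec_eq_iff real_diag_mult_matrix) (simp add: real_diag_def)
  have "mat_fun f A ** mat_fun g A = U ** real_diag (\<lambda>x. f (l x)) ** (cnj_transpose U ** U) **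
          real_diag (\<lambda>x. g (l x)) ** cnj_transpose U"
    using U by (simp add: mat_fun_eq comp_def matrix_mul_assoc)
  also have "\<dots> = mat_fun (\<lambda>x. f x * g x) A"
    using U by (simp add: mat_fun_eq comp_def d unitary_mat_def matrix_mul_assoc)
  finally show ?thesis ..
qed

lemma mat_fun_scaleR:
  assumes "self_adjoint A"
  shows "mat_fun f (c *\<^sub>R A) = mat_fun (\<lambda>x. f (c * x)) A"
proof -
  have "c *\<^sub>R A = mat_fun (\<lambda>x. c) A ** mat_fun (\<lambda>x. x) A"
    using assms by (simp add: mat_fun_const mat_fun_id matrix_mult_scaleR_left)
  also have "\<dots> = mat_fun (\<lambda>x. c * x) A"
    by (simp add: mat_fun_mult[OF assms])
  finally show ?thesis
    by (simp add: mat_fun_comp[OF assms] comp_def)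
qed

section \<open>Traces and quadratic forms\<close>

definition rtr :: "complex^'d^'d \<Rightarrow> real" where
  "rtr A = Re (trace A)"

lemma linear_rtr: "linear rtr"
  by (rule linearI) (simp_all add: rtr_def trace_def sum.distrib sum_distrib_left)

lemmas rtr_add = linear_add[OF linear_rtr]
  and rtr_diff = linear_diff[OF linear_rtr]
  and rtr_scaleR = linear_scale[OF linear_rtr]

lemma rtr_commute: "rtr (A ** B) = rtr (B ** A)"
  unfolding rtr_def by (rule arg_cong[OF trace_mul_sym])

lemma rtr_adj_mult: "rtr (cnj_transpose P ** Q) = (\<Sum>i\<in>UNIV. \<Sum>j\<in>UNIV. Re (cnj (P $ i $ j) * Q $ i $ j))"
  unfolding rtr_def trace_def matrix_matrix_mult_def cnj_transpose_def
  by (simp only: vec_lambda_beta Re_sum) (rule sum.swap)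

section \<open>Unitary changes of basis and overlaps of eigenbases\<close>

lemma unitary_mat_cancel:
  assumes "unitary_mat U"
  shows "cnj_transpose U ** U = mat 1" "U ** cnj_transpose U = mat 1"
    "A ** cnj_transpose U ** U = A" "A ** U ** cnj_transpose U = A"
proof -
  show 1: "cnj_transpose U ** U = mat 1" and 2: "U ** cnj_transpose U = mat 1"
    using assms by (auto simp: unitary_mat_def)
  show "A ** cnj_transpose U ** U = A" "A ** U ** cnj_transpose U = A"
    by (simp_all add: matrix_mul_assoc[symmetric] 1 2)
qed

text \<open>The Hilbert-Schmidt inner product is invariant under different unitaries on the two
  sides. Thus one matrix can be diagonalised from the left and another, not commuting with it, from
  the right.\<close>

lemma rtr_adj_mult_unitary:
  assumes U: "unitary_mat U" and V: "unitary_mat V"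
  shows "rtr (cnj_transpose W ** Z) =
    rtr (cnj_transpose (cnj_transpose U ** W ** V) ** (cnj_transpose U ** Z ** V))"
proof -
  have "rtr (cnj_transpose (cnj_transpose U ** W ** V) ** (cnj_transpose U ** Z ** V))
      = rtr (cnj_transpose V ** (cnj_transpose W ** Z ** V))"
    by (simp add: adj_mult matrix_mul_assoc unitary_mat_cancel[OF U])
  also have "\<dots> = rtr (cnj_transpose W ** Z)"
    by (subst rtr_commute) (simp add: unitary_mat_cancel[OF V])
  finally show ?thesis ..
qed

text \<open>These are the squared moduli of the inner products between the columns of
  \<open>U\<close> and those of \<open>V\<close>. For unitary matrices they form a doubly stochastic
  array, which turns traces involving two noncommuting matrices into weighted sums of scalar
  expressions in their eigenvalues.\<close>

definition overlap :: "complex^'d^'d \<Rightarrow> complex^'d^'d \<Rightarrow> 'd \<Rightarrow> 'd \<Rightarrow> real" where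
  "overlap U V i j = (norm ((cnj_transpose U ** V) $ i $ j))\<^sup>2"

lemma overlap_nonneg [simp]: "overlap U V i j \<ge> 0"
  by (simp add: overlap_def)

text \<open>The product \<open>?R\<close> is unitary, so each of its rows has norm one.\<close>

lemma sum_overlap_right:
  assumes U: "unitary_mat U" and V: "unitary_mat V"
  shows "(\<Sum>j\<in>UNIV. overlap U V i j) = 1"
proof -
  let ?R = "cnj_transpose U ** V"
  have "?R ** cnj_transpose ?R = mat 1"
    by (simp add: adj_mult matrix_mul_assoc unitary_mat_cancel[OF U] unitary_mat_cancel[OF V])
  hence "(?R ** cnj_transpose ?R) $ i $ i = 1" by (simp add: mat_def)
  moreover have "(?R ** cnj_transpose ?R) $ i $ i = complex_of_real (\<Sum>j\<in>UNIV. overlap U V i j)"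
    unfolding matrix_matrix_mult_def[of ?R] cnj_transpose_def[of ?R] overlap_def
    by (simp add: complex_norm_square del: of_real_power)
  ultimately show ?thesis by (simp del: of_real_sum)
qed

lemma overlap_swap: "overlap U V i j = overlap V U j i"
proof -
  have "cnj_transpose (cnj_transpose V ** U) $ i $ j = (cnj_transpose U ** V) $ i $ j"
    by (simp add: adj_mult)
  hence "(cnj_transpose U ** V) $ i $ j = cnj ((cnj_transpose V ** U) $ j $ i)"
    by (simp add: cnj_transpose_def)
  thus ?thesis by (simp add: overlap_def)
qed

lemma sum_overlap_left:
  "unitary_mat U \<Longrightarrow> unitary_mat V \<Longrightarrow> (\<Sum>i\<in>UNIV. overlap U V i j) = 1"
  by (subst overlap_swap) (rule sum_overlap_right)

lemma rtr_conj:
  assumes U: "unitary_mat U"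
  shows "rtr (U ** real_diag l ** cnj_transpose U) = (\<Sum>i\<in>UNIV. l i)"
  by (subst rtr_commute)
     (simp add: matrix_mul_assoc unitary_mat_cancel[OF U] rtr_def trace_def real_diag_def)

lemma rtr_conj_mult:
  assumes U: "unitary_mat U" and V: "unitary_mat V"
  shows "rtr ((U ** real_diag x ** cnj_transpose U) ** (V ** real_diag a ** cnj_transpose V))
    = (\<Sum>i\<in>UNIV. \<Sum>j\<in>UNIV. overlap U V i j * (x i * a j))"
proof -
  let ?X = "U ** real_diag x ** cnj_transpose U" and ?A = "V ** real_diag a ** cnj_transpose V"
  let ?R = "cnj_transpose U ** V"
  have X: "cnj_transpose ?X = ?X" using self_adjoint_conj by (simp add: self_adjoint_def)
  have "rtr (?X ** ?A) = rtr (cnj_transpose ?X ** ?A)" by (simp add: X)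
  also have "\<dots> = rtr (cnj_transpose (real_diag x ** ?R) ** (?R ** real_diag a))"
    by (subst rtr_adj_mult_unitary[OF U V])
       (simp add: matrix_mul_assoc unitary_mat_cancel[OF U] unitary_mat_cancel[OF V])
  also have "\<dots> = (\<Sum>i\<in>UNIV. \<Sum>j\<in>UNIV. overlap U V i j * (x i * a j))"
    unfolding rtr_adj_mult matrix_mult_real_diag real_diag_mult_matrix overlap_def
    by (intro sum.cong refl) (simp add: cmod_power2, simp add: power2_eq_square algebra_simps)
  finally show ?thesis .
qed

lemma inner_conj:
  "x \<bullet> ((U ** real_diag l ** cnj_transpose U) *v x) = (\<Sum>i\<in>UNIV. l i * (norm ((cnj_transpose U *v x) $ i))\<^sup>2)"
proof -
  let ?y = "cnj_transpose U *v x"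
  have "x \<bullet> ((U ** real_diag l ** cnj_transpose U) *v x) = x \<bullet> (U *v (real_diag l *v ?y))"
    by (simp add: matrix_vector_mul_assoc matrix_mul_assoc)
  also have "\<dots> = ?y \<bullet> (real_diag l *v ?y)" by (rule inner_adj)
  also have "\<dots> = (\<Sum>i\<in>UNIV. l i * (norm (?y $ i))\<^sup>2)"
    unfolding inner_vec_def
  proof (rule sum.cong)
    fix i
    have "(real_diag l *v ?y) $ i = l i *\<^sub>R (?y $ i)"
      by (simp add: matrix_vector_mult_def real_diag_def if_distrib[of "\<lambda>x. x * _"] scaleR_conv_of_real
          cong: if_cong)
    thus "?y $ i \<bullet> (real_diag l *v ?y) $ i = l i * (norm (?y $ i))\<^sup>2"
      by (simp only: inner_scaleR_right power2_norm_eq_inner)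
  qed simp
  finally show ?thesis .
qed

lemma norm_unitary_mult:
  assumes U: "unitary_mat U"
  shows "(\<Sum>i\<in>UNIV. (norm ((cnj_transpose U *v x) $ i))\<^sup>2) = (norm x)\<^sup>2"
proof -
  have "(\<Sum>i\<in>UNIV. (norm ((cnj_transpose U *v x) $ i))\<^sup>2) = (cnj_transpose U *v x) \<bullet> (cnj_transpose U *v x)"
    by (simp add: inner_vec_def power2_norm_eq_inner)
  also have "\<dots> = x \<bullet> (U *v (cnj_transpose U *v x))" by (rule inner_adj[symmetric])
  also have "\<dots> = (norm x)\<^sup>2"
    by (simp add: matrix_vector_mul_assoc unitary_mat_cancel[OF U] power2_norm_eq_inner)
  finally show ?thesis .
qed

text \<open>Since \<open>inner\<close> is the real part of \<open>cinner\<close>, this is the usual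
  positive semidefiniteness when \<open>A\<close> is self-adjoint.\<close>

definition psd :: "complex^'d^'d \<Rightarrow> bool" where
  "psd A \<longleftrightarrow> (\<forall>x. 0 \<le> x \<bullet> (A *v x))"

text \<open>In the basis \<open>U\<close> the trace is the sum of \<open>l i\<close> times the
  diagonal entries of the conjugated \<open>P\<close>, and each such entry is a value of the
  quadratic form of \<open>P\<close>.\<close>

lemma rtr_conj_mult_psd:
  assumes P: "psd P" and l: "\<And>i. 0 \<le> l i"
  shows "0 \<le> rtr ((U ** real_diag l ** cnj_transpose U) ** P)"
proof -
  have "rtr ((U ** real_diag l ** cnj_transpose U) ** P) = rtr (real_diag l ** (cnj_transpose U ** P ** U))"
    using rtr_commute[of U "real_diag l ** cnj_transpose U ** P"] by (simp add: matrix_mul_assoc)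
  also have "\<dots> = (\<Sum>i\<in>UNIV. l i * Re ((cnj_transpose U ** P ** U) $ i $ i))"
    by (simp add: rtr_def trace_def real_diag_mult_matrix)
  also have "\<dots> \<ge> 0"
  proof (intro sum_nonneg mult_nonneg_nonneg l)
    fix i
    let ?e = "axis i 1 :: complex^'a"
    have "0 \<le> (U *v ?e) \<bullet> (P *v (U *v ?e))" using P by (simp add: psd_def)
    also have "\<dots> = ?e \<bullet> (cnj_transpose U *v (P *v (U *v ?e)))"
      using inner_adj[of ?e "cnj_transpose U"] by simp
    also have "\<dots> = ?e \<bullet> ((cnj_transpose U ** P ** U) *v ?e)"
      by (simp add: matrix_vector_mul_assoc matrix_mul_assoc)
    also have "\<dots> = Re ((cnj_transpose U ** P ** U) $ i $ i)"
      by (simp add: inner_eq_Re_cinner cinner_def axis_def matrix_vector_mult_def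
          if_distrib[of "\<lambda>x. _ * x"] if_distrib[of "\<lambda>x. x * _"] if_distrib[of cnj] cong: if_cong)
    finally show "0 \<le> Re ((cnj_transpose U ** P ** U) $ i $ i)" .
  qed
  finally show ?thesis .
qed

lemma rtr_mat_fun_mult_psd:
  assumes "self_adjoint A" "psd P" "\<And>x. 0 \<le> f x"
  shows "0 \<le> rtr (mat_fun f A ** P)"
  using assms by (elim self_adjoint_spectral) (simp add: mat_fun_eq rtr_conj_mult_psd)

lemma psd_mat_fun_diff:
  assumes A: "self_adjoint A" and le: "\<And>x. f x \<le> g x"
  shows "psd (mat_fun g A - mat_fun f A)"
proof -
  obtain U l where U: "unitary_mat U" "A = U ** real_diag l ** cnj_transpose U"
    using A by (rule self_adjoint_spectral)
  show ?thesis
    unfolding psd_def U(2)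
    by (auto simp: mat_fun_eq[OF U(1)] inner_conj matrix_vector_mult_diff_rdistrib inner_diff_right
        intro!: sum_mono mult_right_mono le simp del: sum_subtractf)
qed

text \<open>Positive definiteness makes all eigenvalues positive, where \<open>exp\<close> inverts
  \<open>ln\<close>. Every positive definite matrix is thus an exponential, the form in which the
  relative entropy below takes its arguments.\<close>

lemma mat_fun_ln_exp:
  fixes P :: "complex^'d^'d"
  assumes A: "self_adjoint P" and pos: "\<And>x. x \<noteq> 0 \<Longrightarrow> 0 < x \<bullet> (P *v x)"
  shows "mat_fun exp (mat_fun ln P) = P"
proof -
  obtain U l where U: "unitary_mat U" "P = U ** real_diag l ** cnj_transpose U"
    using A by (rule self_adjoint_spectral)
  have "l i > 0" for i
  proof -
    let ?e = "axis i 1 :: complex^'d"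
    have "cnj_transpose U *v (U *v ?e) = ?e"
      by (simp add: matrix_vector_mul_assoc unitary_mat_cancel[OF U(1)])
    moreover from this have "U *v ?e \<noteq> 0" by auto
    ultimately show ?thesis
      using pos[of "U *v ?e"] unfolding U(2) inner_conj
      by (simp add: axis_def if_distrib[of norm] if_distrib[of "\<lambda>x. x^2"] if_distrib[of "\<lambda>x. _ * x"] cong: if_cong)
  qed
  hence "(exp \<circ> (ln \<circ> l)) = l" by (auto simp: comp_def)
  thus ?thesis using U by (simp add: mat_fun_eq)
qed

section \<open>Quantum relative entropy\<close>

text \<open>This is $\mathrm{tr}(X \log X - X \log A - X + A)$ for $X = e^S$ and $A = e^L$.\<close>
definition rel_ent :: "complex^'d^'d \<Rightarrow> complex^'d^'d \<Rightarrow> real" where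
  "rel_ent S L = rtr (mat_fun exp S ** (S - L)) - rtr (mat_fun exp S) + rtr (mat_fun exp L)"

text \<open>Because the overlaps sum to one along rows and columns, the traces of a single matrix
  can also be spread over the double sum. All terms then merge into the scalar entropy of
  \<open>exp (s i)\<close> relative to \<open>exp (l j)\<close>.\<close>

lemma rel_ent_conj:
  assumes U: "unitary_mat U" and V: "unitary_mat V"
  shows "rel_ent (U ** real_diag s ** cnj_transpose U) (V ** real_diag l ** cnj_transpose V)
    = (\<Sum>i\<in>UNIV. \<Sum>j\<in>UNIV. overlap U V i j * (exp (s i) * (s i - l j) - exp (s i) + exp (l j)))"
proof -
  let ?S = "U ** real_diag s ** cnj_transpose U" and ?L = "V ** real_diag l ** cnj_transpose V"
  have S: "self_adjoint ?S" by (rule self_adjoint_conj)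
  have 1: "(\<Sum>i\<in>UNIV. \<Sum>j\<in>UNIV. overlap U V i j * f i) = (\<Sum>i\<in>UNIV. f i)" for f
    by (simp add: sum_distrib_right[symmetric] sum_overlap_right[OF U V])
  have 2: "(\<Sum>i\<in>UNIV. \<Sum>j\<in>UNIV. overlap U V i j * f j) = (\<Sum>i\<in>UNIV. f i)" for f
    by (subst sum.swap) (simp add: sum_distrib_right[symmetric] sum_overlap_left[OF U V])
  have "mat_fun exp ?S ** ?S = mat_fun (\<lambda>x. exp x * x) ?S"
    by (simp add: mat_fun_mult[OF S] mat_fun_id[OF S])
  hence "rel_ent ?S ?L = (\<Sum>i\<in>UNIV. exp (s i) * s i)
      - (\<Sum>i\<in>UNIV. \<Sum>j\<in>UNIV. overlap U V i j * (exp (s i) * l j))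
      - (\<Sum>i\<in>UNIV. exp (s i)) + (\<Sum>i\<in>UNIV. exp (l i))"
    by (simp add: rel_ent_def matrix_mult_diff_right rtr_diff mat_fun_eq U V rtr_conj rtr_conj_mult comp_def)
  also have "\<dots> = (\<Sum>i\<in>UNIV. \<Sum>j\<in>UNIV. overlap U V i j * (exp (s i) * s i))
      - (\<Sum>i\<in>UNIV. \<Sum>j\<in>UNIV. overlap U V i j * (exp (s i) * l j))
      - (\<Sum>i\<in>UNIV. \<Sum>j\<in>UNIV. overlap U V i j * exp (s i))
      + (\<Sum>i\<in>UNIV. \<Sum>j\<in>UNIV. overlap U V i j * exp (l j))"
    unfolding 1 2 ..
  also have "\<dots> = (\<Sum>i\<in>UNIV. \<Sum>j\<in>UNIV. overlap U V i j * (exp (s i) * (s i - l j) - exp (s i) + exp (l j)))"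
    by (simp add: sum.distrib sum_subtractf algebra_simps)
  finally show ?thesis .
qed

text \<open>This is Klein's inequality. Each scalar term is nonnegative by
  \<open>1 + y \<le> exp y\<close> at \<open>y = l - s\<close>.\<close>

lemma rel_ent_nonneg:
  assumes "self_adjoint S" "self_adjoint L"
  shows "rel_ent S L \<ge> 0"
proof -
  have *: "0 \<le> exp s * (s - l) - exp s + exp l" for s l :: real
  proof -
    have "exp s * (1 + (l - s)) \<le> exp s * exp (l - s)"
      by (intro mult_left_mono exp_ge_add_one_self) simp
    thus ?thesis by (simp add: exp_add[symmetric] algebra_simps)
  qed
  obtain U s where U: "unitary_mat U" "S = U ** real_diag s ** cnj_transpose U"
    using assms(1) by (rule self_adjoint_spectral)
  obtain V l where V: "unitary_mat V" "L = V ** real_diag l ** cnj_transpose V"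
    using assms(2) by (rule self_adjoint_spectral)
  show ?thesis
    unfolding U(2) V(2) rel_ent_conj[OF U(1) V(1)]
    by (intro sum_nonneg mult_nonneg_nonneg * overlap_nonneg)
qed

text \<open>Convexity of the trace exponential gives its monotonicity.\<close>
lemma rtr_exp_mono:
  assumes S: "self_adjoint S" and L: "self_adjoint L" and le: "psd (L - S)"
  shows "rtr (mat_fun exp S) \<le> rtr (mat_fun exp L)"
proof -
  have "0 \<le> rtr (mat_fun exp S ** (L - S))"
    by (rule rtr_mat_fun_mult_psd[OF S le]) simp
  moreover have "rtr (mat_fun exp S ** (L - S)) = - rtr (mat_fun exp S ** (S - L))"
    by (simp add: matrix_mult_diff_right rtr_diff)
  ultimately show ?thesis
    using rel_ent_nonneg[OF S L] by (simp add: rel_ent_def)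
qed

text \<open>Expanding the Hilbert-Schmidt distance with the same overlap weights allows a termwise
  comparison with the relative entropy.\<close>

lemma rtr_square_diff_conj:
  assumes U: "unitary_mat U" and V: "unitary_mat V"
  shows "rtr ((U ** real_diag x ** cnj_transpose U - V ** real_diag a ** cnj_transpose V) **
              (U ** real_diag x ** cnj_transpose U - V ** real_diag a ** cnj_transpose V))
    = (\<Sum>i\<in>UNIV. \<Sum>j\<in>UNIV. overlap U V i j * (x i - a j)\<^sup>2)"
proof -
  let ?X = "U ** real_diag x ** cnj_transpose U" and ?A = "V ** real_diag a ** cnj_transpose V"
  have 1: "rtr (?X ** ?X) = (\<Sum>i\<in>UNIV. \<Sum>j\<in>UNIV. overlap U V i j * (x i)\<^sup>2)"
  proof -
    have "?X ** ?X = mat_fun (\<lambda>t. t * t) ?X"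
      by (simp add: mat_fun_mult mat_fun_id self_adjoint_conj)
    thus ?thesis
      by (simp add: mat_fun_eq U rtr_conj sum_distrib_right[symmetric] sum_overlap_right[OF U V] power2_eq_square)
  qed
  have 2: "rtr (?A ** ?A) = (\<Sum>i\<in>UNIV. \<Sum>j\<in>UNIV. overlap U V i j * (a j)\<^sup>2)"
  proof -
    have "?A ** ?A = mat_fun (\<lambda>t. t * t) ?A"
      by (simp add: mat_fun_mult mat_fun_id self_adjoint_conj)
    thus ?thesis
      by (subst sum.swap)
         (simp add: mat_fun_eq V rtr_conj sum_distrib_right[symmetric] sum_overlap_left[OF U V] power2_eq_square)
  qed
  have "rtr ((?X - ?A) ** (?X - ?A)) = rtr (?X ** ?X) - 2 * rtr (?X ** ?A) + rtr (?A ** ?A)"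
    by (simp add: matrix_mult_diff_right matrix_mult_diff_left rtr_diff rtr_commute[of ?A ?X])
  also have "\<dots> = (\<Sum>i\<in>UNIV. \<Sum>j\<in>UNIV. overlap U V i j * (x i - a j)\<^sup>2)"
    unfolding 1 2 rtr_conj_mult[OF U V]
    by (simp add: sum_distrib_left sum_subtractf[symmetric] sum.distrib[symmetric]
        power2_eq_square algebra_simps)
  finally show ?thesis .
qed

text \<open>With \<open>x = exp s\<close> and \<open>a = exp (l j)\<close>, the bound
  \<open>ln y \<le> y - 1\<close> shows that the scalar entropy is at most
  \<open>(x - a)^2 / a\<close>. The constant \<open>C\<close> is the trace of
  \<open>exp (- N)\<close> and depends on \<open>N\<close> alone; the bound says that the entropy
  vanishes to second order at \<open>S = N\<close>.\<close>

lemma rel_ent_le_square: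
  assumes "self_adjoint N"
  obtains C where "C \<ge> 0" "\<And>S. self_adjoint S \<Longrightarrow>
     rel_ent S N \<le> C * rtr ((mat_fun exp S - mat_fun exp N) ** (mat_fun exp S - mat_fun exp N))"
proof -
  obtain V l where V: "unitary_mat V" "N = V ** real_diag l ** cnj_transpose V"
    using assms by (rule self_adjoint_spectral)
  define C where "C = (\<Sum>j\<in>UNIV. exp (- l j))"
  have C: "exp (- l j) \<le> C" for j
    unfolding C_def by (rule member_le_sum) auto
  have le: "exp s * (s - l j) - exp s + exp (l j) \<le> C * (exp s - exp (l j))\<^sup>2" for s j
  proof -
    have "s - l j \<le> exp (s - l j) - 1" using exp_ge_add_one_self[of "s - l j"] by linarith
    hence "exp s * (s - l j) \<le> exp s * (exp (s - l j) - 1)" by simp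
    hence "exp s * (s - l j) - exp s + exp (l j) \<le> exp (- l j) * (exp s - exp (l j))\<^sup>2"
      by (simp add: power2_eq_square algebra_simps exp_diff exp_minus divide_simps)
    also have "\<dots> \<le> C * (exp s - exp (l j))\<^sup>2" by (intro mult_right_mono C) simp
    finally show ?thesis .
  qed
  show ?thesis
  proof (rule that[of C])
    show "C \<ge> 0" by (auto simp: C_def intro: sum_nonneg)
    fix S :: "complex^'a^'a" assume "self_adjoint S"
    then obtain U s where U: "unitary_mat U" "S = U ** real_diag s ** cnj_transpose U"
      by (rule self_adjoint_spectral)
    show "rel_ent S N \<le> C * rtr ((mat_fun exp S - mat_fun exp N) ** (mat_fun exp S - mat_fun exp N))"
      unfolding U(2) V(2) rel_ent_conj[OF U(1) V(1)] mat_fun_eq[OF U(1)] mat_fun_eq[OF V(1)]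
        rtr_square_diff_conj[OF U(1) V(1)] sum_distrib_left
      by (intro sum_mono) (use le in \<open>simp add: mult.left_commute[of C] mult_left_mono\<close>)
  qed
qed

section \<open>Supporting functionals of the relative entropy\<close>

text \<open>Write \<open>p\<close> for the denominator. The derivative of
  \<open>u * (a - x) - x * ln p\<close> is \<open>(a - x) * (p - x) / p\<close>, and
  \<open>p - x = u * (a - x)\<close>.\<close>

lemma entropy_integral:
  fixes x a :: real
  assumes x: "x > 0" and a: "a > 0"
  shows "((\<lambda>u. u * ((a - x)\<^sup>2 / (u * a + (1 - u) * x))) has_integral (x * (ln x - ln a) - x + a)) {0..1}"
proof -
  have pos: "u * a + (1 - u) * x > 0" if "0 \<le> u" "u \<le> 1" for u
    using that x a by (cases "u = 0") (auto intro!: add_pos_nonneg)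
  have "((\<lambda>u. u * ((a - x)\<^sup>2 / (u * a + (1 - u) * x))) has_integral
      ((1 * (a - x) - x * ln (1 * a + (1 - 1) * x)) - (0 * (a - x) - x * ln (0 * a + (1 - 0) * x)))) {0..1}"
  proof (rule fundamental_theorem_of_calculus[where f = "\<lambda>u. u * (a - x) - x * ln (u * a + (1 - u) * x)"])
    fix u :: real assume "u \<in> {0..1}"
    hence u: "u * a + (1 - u) * x > 0" using pos by simp
    have eq: "(a - x) - x * ((a - x) / (u * a + (1 - u) * x)) = u * ((a - x)\<^sup>2 / (u * a + (1 - u) * x))"
      using u by (simp add: field_simps power2_eq_square)
    have "((\<lambda>u. u * (a - x) - x * ln (u * a + (1 - u) * x)) has_real_derivative
        ((a - x) - x * ((a - x) / (u * a + (1 - u) * x)))) (at u within {0..1})"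
      using u by (auto intro!: derivative_eq_intros)
    thus "((\<lambda>u. u * (a - x) - x * ln (u * a + (1 - u) * x)) has_vector_derivative
        u * ((a - x)\<^sup>2 / (u * a + (1 - u) * x))) (at u within {0..1})"
      unfolding eq has_real_derivative_iff_has_vector_derivative .
  qed simp
  thus ?thesis by (simp add: algebra_simps)
qed

text \<open>
  Let $\mathcal P$ be the operator $W \mapsto uWA + (1-u)XW$ on matrices. Then this is
  $2\langle W, A - X\rangle - \langle W, \mathcal P W\rangle$, whose maximum over $W$ is
  $\langle A - X, \mathcal P^{-1}(A - X)\rangle$.
\<close>
definition dual_form :: "real \<Rightarrow> complex^'d^'d \<Rightarrow> complex^'d^'d \<Rightarrow> complex^'d^'d \<Rightarrow> real" where
  "dual_form u W X A = 2 * rtr (cnj_transpose W ** (A - X))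
     - u * rtr (cnj_transpose W ** (W ** A)) - (1 - u) * rtr (cnj_transpose W ** (X ** W))"

text \<open>For fixed \<open>u\<close> and \<open>W\<close> the form is linear in the pair of
  \<open>X\<close> and \<open>A\<close>, so each choice of \<open>W\<close> yields a linear
  minorant.\<close>

lemma dual_form_add: "dual_form u W (X + X') (A + A') = dual_form u W X A + dual_form u W X' A'"
  unfolding dual_form_def add_diff_add matrix_add_ldistrib matrix_mult_add_left rtr_add distrib_left
  by simp

lemma dual_form_scaleR: "dual_form u W (c *\<^sub>R X) (c *\<^sub>R A) = c * dual_form u W X A"
  unfolding dual_form_def scaleR_diff_right[symmetric] matrix_mult_scaleR_left matrix_mult_scaleR_right rtr_scaleR
  by (simp add: right_diff_distrib mult.left_commute)

text \<open>In the left basis \<open>U\<close> and the right basis \<open>V\<close> the operator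
  described above becomes diagonal: it multiplies the entry at \<open>i\<close>, \<open>j\<close> by
  \<open>u * a j + (1 - u) * x i\<close>.\<close>

lemma dual_form_conj:
  fixes U V W :: "complex^'d^'d"
  assumes U: "unitary_mat U" and V: "unitary_mat V"
  defines "R \<equiv> cnj_transpose U ** V" and "C \<equiv> cnj_transpose U ** W ** V"
  shows "dual_form u W (U ** real_diag x ** cnj_transpose U) (V ** real_diag a ** cnj_transpose V) =
    (\<Sum>i\<in>UNIV. \<Sum>j\<in>UNIV. 2 * (C $ i $ j \<bullet> R $ i $ j) * (a j - x i)
        - (norm (C $ i $ j))\<^sup>2 * (u * a j + (1 - u) * x i))"
proof -
  let ?X = "U ** real_diag x ** cnj_transpose U" and ?A = "V ** real_diag a ** cnj_transpose V"
  have 1: "rtr (cnj_transpose W ** (?A - ?X)) = (\<Sum>i\<in>UNIV. \<Sum>j\<in>UNIV. (C $ i $ j \<bullet> R $ i $ j) * (a j - x i))"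
  proof -
    have "cnj_transpose U ** (?A - ?X) ** V = R ** real_diag a - real_diag x ** R"
      by (simp add: matrix_mult_diff_right matrix_mult_diff_left matrix_mul_assoc
          unitary_mat_cancel[OF U] unitary_mat_cancel[OF V] R_def)
    hence "rtr (cnj_transpose W ** (?A - ?X)) = rtr (cnj_transpose C ** (R ** real_diag a - real_diag x ** R))"
      unfolding C_def by (subst rtr_adj_mult_unitary[OF U V]) simp
    thus ?thesis
      unfolding rtr_adj_mult
      by (simp add: matrix_mult_real_diag real_diag_mult_matrix inner_complex_def)
         (intro sum.cong refl, simp add: algebra_simps)
  qed
  have 2: "rtr (cnj_transpose W ** (W ** ?A)) = (\<Sum>i\<in>UNIV. \<Sum>j\<in>UNIV. (norm (C $ i $ j))\<^sup>2 * a j)"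
  proof -
    have "cnj_transpose U ** (W ** ?A) ** V = C ** real_diag a"
      by (simp add: matrix_mul_assoc unitary_mat_cancel[OF V] C_def)
    hence "rtr (cnj_transpose W ** (W ** ?A)) = rtr (cnj_transpose C ** (C ** real_diag a))"
      unfolding C_def by (subst rtr_adj_mult_unitary[OF U V]) simp
    thus ?thesis
      unfolding rtr_adj_mult
      by (simp add: matrix_mult_real_diag cmod_power2)
         (intro sum.cong refl, simp add: algebra_simps power2_eq_square)
  qed
  have 3: "rtr (cnj_transpose W ** (?X ** W)) = (\<Sum>i\<in>UNIV. \<Sum>j\<in>UNIV. (norm (C $ i $ j))\<^sup>2 * x i)"
  proof -
    have "cnj_transpose U ** (?X ** W) ** V = real_diag x ** C"
      by (simp add: matrix_mul_assoc unitary_mat_cancel[OF U] C_def)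
    hence "rtr (cnj_transpose W ** (?X ** W)) = rtr (cnj_transpose C ** (real_diag x ** C))"
      unfolding C_def by (subst rtr_adj_mult_unitary[OF U V]) simp
    thus ?thesis
      unfolding rtr_adj_mult
      by (simp add: real_diag_mult_matrix cmod_power2)
         (intro sum.cong refl, simp add: algebra_simps power2_eq_square)
  qed
  show ?thesis
    unfolding dual_form_def 1 2 3
    by (simp add: sum_distrib_left sum_subtractf[symmetric] algebra_simps)
qed

text \<open>Complete the square in each entry separately. The bound holds for every
  \<open>W\<close>, in particular for one adapted to other matrices.\<close>

lemma dual_form_le:
  assumes U: "unitary_mat U" and V: "unitary_mat V"
    and p: "\<And>i j. u * a j + (1 - u) * x i > 0"
  shows "dual_form u W (U ** real_diag x ** cnj_transpose U) (V ** real_diag a ** cnj_transpose V)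
    \<le> (\<Sum>i\<in>UNIV. \<Sum>j\<in>UNIV. overlap U V i j * ((a j - x i)\<^sup>2 / (u * a j + (1 - u) * x i)))"
proof -
  have *: "2 * (c \<bullet> r) * d - (norm c)\<^sup>2 * p \<le> (norm r)\<^sup>2 * (d\<^sup>2 / p)" if "p > 0" for c r :: complex and d p :: real
  proof -
    have "0 \<le> (norm (p *\<^sub>R c - d *\<^sub>R r))\<^sup>2 / p" using that by simp
    also have "\<dots> = (norm c)\<^sup>2 * p - 2 * (c \<bullet> r) * d + (norm r)\<^sup>2 * (d\<^sup>2 / p)"
      using that unfolding power2_norm_eq_inner
      by (simp add: inner_diff_left inner_diff_right inner_commute[of r c] field_simps power2_eq_square)
    finally show ?thesis by simp
  qed
  show ?thesis
    unfolding dual_form_conj[OF U V] overlap_def by (intro sum_mono * p)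
qed

text \<open>The matrix \<open>C\<close> holds the coordinates of the maximiser: each entry of the
  difference of the two matrices is divided by the corresponding multiplier, so the completed
  squares vanish.\<close>

lemma dual_form_eq:
  fixes U V :: "complex^'d^'d"
  assumes U: "unitary_mat U" and V: "unitary_mat V"
    and p: "\<And>i j. u * a j + (1 - u) * x i > 0"
  defines "C \<equiv> \<chi> i j. ((a j - x i) / (u * a j + (1 - u) * x i)) *\<^sub>R (cnj_transpose U ** V) $ i $ j"
  shows "dual_form u (U ** C ** cnj_transpose V)
      (U ** real_diag x ** cnj_transpose U) (V ** real_diag a ** cnj_transpose V)
    = (\<Sum>i\<in>UNIV. \<Sum>j\<in>UNIV. overlap U V i j * ((a j - x i)\<^sup>2 / (u * a j + (1 - u) * x i)))"
proof -
  have C: "cnj_transpose U ** (U ** C ** cnj_transpose V) ** V = C"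
    by (simp add: matrix_mul_assoc unitary_mat_cancel[OF U] unitary_mat_cancel[OF V])
  have *: "2 * ((d / p) *\<^sub>R r \<bullet> r) * d - (norm ((d / p) *\<^sub>R r))\<^sup>2 * p = (norm r)\<^sup>2 * (d\<^sup>2 / p)"
    if "p > 0" for r :: complex and d p :: real
    using that unfolding power2_norm_eq_inner by (simp add: field_simps power2_eq_square)
  show ?thesis
    unfolding dual_form_conj[OF U V] C overlap_def
    by (intro sum.cong refl) (simp only: C_def vec_lambda_beta *[OF p])
qed

lemma continuous_on_matrix_mult:
  fixes f g :: "'b::topological_space \<Rightarrow> complex^'d^'d"
  assumes "continuous_on S f" "continuous_on S g"
  shows "continuous_on S (\<lambda>u. f u ** g u)"
  unfolding matrix_matrix_mult_def
  by (intro continuous_on_vec_lambda continuous_intros continuous_on_component assms)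

lemma continuous_on_cnj_transpose:
  "continuous_on S f \<Longrightarrow> continuous_on S (\<lambda>u. cnj_transpose (f u))"
  unfolding cnj_transpose_def
  by (intro continuous_on_vec_lambda continuous_intros continuous_on_component)

lemma continuous_on_rtr:
  "continuous_on S f \<Longrightarrow> continuous_on S (\<lambda>u. rtr (f u))"
  unfolding rtr_def trace_def
  by (intro continuous_intros continuous_on_component)

lemma continuous_on_dual_form:
  assumes "continuous_on S W"
  shows "continuous_on S (\<lambda>u. dual_form u (W u) X A)"
  unfolding dual_form_def
  by (intro continuous_intros continuous_on_rtr continuous_on_matrix_mult continuous_on_cnj_transpose assms)

text \<open>The joint convexity of the relative entropy, in the form of supporting linear functionals.\<close>
lemma rel_ent_support:
  fixes S\<^sub>0 N :: "complex^'d^'d"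
  assumes S0: "self_adjoint S\<^sub>0" and N: "self_adjoint N"
  obtains g h :: "complex^'d^'d \<Rightarrow> real" where "linear g" "linear h"
    "\<And>S L. self_adjoint S \<Longrightarrow> self_adjoint L \<Longrightarrow> g (mat_fun exp S) + h (mat_fun exp L) \<le> rel_ent S L"
    "g (mat_fun exp S\<^sub>0) + h (mat_fun exp N) = rel_ent S\<^sub>0 N"
proof -
  obtain U0 s0 where U0: "unitary_mat U0" "S\<^sub>0 = U0 ** real_diag s0 ** cnj_transpose U0"
    using S0 by (rule self_adjoint_spectral)
  obtain V0 l0 where V0: "unitary_mat V0" "N = V0 ** real_diag l0 ** cnj_transpose V0"
    using N by (rule self_adjoint_spectral)
  have pos: "u * exp b + (1 - u) * exp x > 0" if "u \<in> {0..1}" for u b x :: real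
    using that by (cases "u = 0") (auto intro!: add_pos_nonneg)
  \<comment> \<open>The dual variable is frozen at the maximiser for the base pair
    \<open>S\<^sub>0\<close>, \<open>N\<close>. For every other pair it gives only a lower bound,
    but one that is linear.\<close>
  define C :: "real \<Rightarrow> complex^'d^'d" where "C u = (\<chi> i j. ((exp (l0 j) - exp (s0 i)) / (u * exp (l0 j) + (1 - u) * exp (s0 i)))
      *\<^sub>R (cnj_transpose U0 ** V0) $ i $ j)" for u
  define W where "W u = U0 ** C u ** cnj_transpose V0" for u
  have "continuous_on {0..1} C"
    unfolding C_def
    by (intro continuous_on_vec_lambda continuous_intros ballI) (use pos in \<open>simp add: less_imp_neq[symmetric]\<close>)
  hence W: "continuous_on {0..1} W"
    unfolding W_def by (intro continuous_on_matrix_mult continuous_on_const)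
  have int: "(\<lambda>u. u * dual_form u (W u) X A) integrable_on {0..1}" for X A
    by (intro integrable_continuous_real continuous_intros continuous_on_dual_form W)
  define G where "G X A = integral {0..1} (\<lambda>u. u * dual_form u (W u) X A)" for X A
  have G_add: "G (X + X') (A + A') = G X A + G X' A'" for X X' A A'
    unfolding G_def dual_form_add distrib_left by (rule Henstock_Kurzweil_Integration.integral_add[OF int int])
  have G_scaleR: "G (c *\<^sub>R X) (c *\<^sub>R A) = c * G X A" for c X A
    unfolding G_def dual_form_scaleR mult.left_commute[of _ c] by (rule Henstock_Kurzweil_Integration.integral_mult_right)
  have g: "linear (\<lambda>X. G X 0)"
    by (rule linearI) (use G_add[of _ _ 0 0] G_scaleR[of _ _ 0] in auto)
  have h: "linear (\<lambda>A. G 0 A)"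
    by (rule linearI) (use G_add[of 0 0] G_scaleR[of _ 0] in auto)
  \<comment> \<open>Additivity in the pair separates the functional into a part in \<open>X\<close>
    and a part in \<open>A\<close>; these become \<open>g\<close> and \<open>h\<close>.\<close>
  have split: "G X 0 + G 0 A = G X A" for X A
    using G_add[of X 0 0 A] by simp
  have main: "((\<lambda>u. u * (\<Sum>i\<in>UNIV. \<Sum>j\<in>UNIV. overlap U V i j *
        ((exp (l j) - exp (s i))\<^sup>2 / (u * exp (l j) + (1 - u) * exp (s i))))) has_integral
      rel_ent (U ** real_diag s ** cnj_transpose U) (V ** real_diag l ** cnj_transpose V)) {0..1}"
    if U: "unitary_mat U" and V: "unitary_mat V" for U V :: "complex^'d^'d" and s l
  proof -
    have "((\<lambda>u. \<Sum>i\<in>UNIV. \<Sum>j\<in>UNIV. overlap U V i j * (u *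
        ((exp (l j) - exp (s i))\<^sup>2 / (u * exp (l j) + (1 - u) * exp (s i))))) has_integral
      (\<Sum>i\<in>UNIV. \<Sum>j\<in>UNIV. overlap U V i j *
          (exp (s i) * (ln (exp (s i)) - ln (exp (l j))) - exp (s i) + exp (l j)))) {0..1}"
      by (intro has_integral_sum has_integral_mult_right entropy_integral) auto
    thus ?thesis
      by (simp add: rel_ent_conj[OF U V] sum_distrib_left mult.left_commute)
  qed
  show ?thesis
  proof (rule that[OF g h])
    fix S L :: "complex^'d^'d"
    assume "self_adjoint S" "self_adjoint L"
    obtain U s where U: "unitary_mat U" "S = U ** real_diag s ** cnj_transpose U"
      using \<open>self_adjoint S\<close> by (rule self_adjoint_spectral)
    obtain V l where V: "unitary_mat V" "L = V ** real_diag l ** cnj_transpose V"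
      using \<open>self_adjoint L\<close> by (rule self_adjoint_spectral)
    show "G (mat_fun exp S) 0 + G 0 (mat_fun exp L) \<le> rel_ent S L"
      unfolding split unfolding G_def U(2) V(2) mat_fun_eq[OF U(1)] mat_fun_eq[OF V(1)]
    proof (rule has_integral_le[OF integrable_integral[OF int] main[OF U(1) V(1)]])
      fix u :: real assume u: "u \<in> {0..1}"
      show "u * dual_form u (W u) (U ** real_diag (exp \<circ> s) ** cnj_transpose U) (V ** real_diag (exp \<circ> l) ** cnj_transpose V)
          \<le> u * (\<Sum>i\<in>UNIV. \<Sum>j\<in>UNIV. overlap U V i j *
               ((exp (l j) - exp (s i))\<^sup>2 / (u * exp (l j) + (1 - u) * exp (s i))))"
        using u dual_form_le[OF U(1) V(1), of u "exp \<circ> l" "exp \<circ> s" "W u"] pos[OF u]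
        by (intro mult_left_mono) auto
    qed
  next
    show "G (mat_fun exp S\<^sub>0) 0 + G 0 (mat_fun exp N) = rel_ent S\<^sub>0 N"
      unfolding split unfolding G_def U0(2) V0(2) mat_fun_eq[OF U0(1)] mat_fun_eq[OF V0(1)]
    proof (rule integral_unique, rule has_integral_eq[OF _ main[OF U0(1) V0(1)]])
      fix u :: real assume u: "u \<in> {0..1}"
      show "u * (\<Sum>i\<in>UNIV. \<Sum>j\<in>UNIV. overlap U0 V0 i j *
               ((exp (l0 j) - exp (s0 i))\<^sup>2 / (u * exp (l0 j) + (1 - u) * exp (s0 i))))
          = u * dual_form u (W u) (U0 ** real_diag (exp \<circ> s0) ** cnj_transpose U0) (V0 ** real_diag (exp \<circ> l0) ** cnj_transpose V0)"
        using dual_form_eq[OF U0(1) V0(1), of u "exp \<circ> l0" "exp \<circ> s0"] pos[OF u]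
        by (simp add: W_def C_def)
    qed
  qed
qed

section \<open>Lieb's concavity theorem\<close>

lemma pos_eigenvalue_bounds:
  fixes S :: "complex^'d^'d"
  assumes S: "self_adjoint S"
  obtains a b where "a > 0" "b > 0" "\<And>x. a * (norm x)\<^sup>2 \<le> x \<bullet> (mat_fun exp S *v x)"
    "\<And>x. x \<bullet> (mat_fun exp S *v x) \<le> b * (norm x)\<^sup>2"
proof -
  obtain U s where U: "unitary_mat U" "S = U ** real_diag s ** cnj_transpose U"
    using S by (rule self_adjoint_spectral)
  define a where "a = exp (Min (range s))"
  define b where "b = exp (Max (range s))"
  have s: "a \<le> exp (s i)" "exp (s i) \<le> b" for i by (auto simp: a_def b_def)
  show ?thesis
  proof (rule that[of a b])
    show "a * (norm x)\<^sup>2 \<le> x \<bullet> (mat_fun exp S *v x)" for x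
      unfolding U(2) mat_fun_eq[OF U(1)] inner_conj norm_unitary_mult[OF U(1), symmetric] sum_distrib_left
      by (intro sum_mono mult_right_mono) (auto simp: s)
    show "x \<bullet> (mat_fun exp S *v x) \<le> b * (norm x)\<^sup>2" for x
      unfolding U(2) mat_fun_eq[OF U(1)] inner_conj norm_unitary_mult[OF U(1), symmetric] sum_distrib_left
      by (intro sum_mono mult_right_mono) (auto simp: s)
  qed (auto simp: a_def b_def)
qed

lemma matrix_vector_scaleR_left: "(c *\<^sub>R A) *v x = c *\<^sub>R (A *v x)" for A :: "complex^'d^'d"
  by (simp add: matrix_vector_mult_def vec_eq_iff scaleR_sum_right)

text \<open>
  Lieb's theorem states that $A \mapsto \mathrm{tr} \exp(K + \log A)$ is concave. As this function
  is homogeneous of degree one, its supporting functionals are linear. With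
  $S = K + L$, the gradient of the relative entropy in its first argument is $K$, so the bound
  of \<open>rel_ent_support\<close> loses its dependence on $e^S$.
\<close>
theorem lieb_support:
  fixes K N :: "complex^'d^'d"
  assumes K: "self_adjoint K" and N: "self_adjoint N"
  obtains \<phi> :: "complex^'d^'d \<Rightarrow> real" where "linear \<phi>"
    "\<And>L. self_adjoint L \<Longrightarrow> rtr (mat_fun exp (K + L)) \<le> \<phi> (mat_fun exp L)"
    "\<phi> (mat_fun exp N) = rtr (mat_fun exp (K + N))"
proof -
  let ?e = "mat_fun exp :: complex^'d^'d \<Rightarrow> complex^'d^'d"
  let ?S0 = "K + N"
  have S0: "self_adjoint ?S0" using K N by (rule self_adjoint_add)
  obtain g h where gh: "linear g" "linear h"
    "\<And>S L. self_adjoint S \<Longrightarrow> self_adjoint L \<Longrightarrow> g (?e S) + h (?e L) \<le> rel_ent S L"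
    "g (?e ?S0) + h (?e N) = rel_ent ?S0 N"
    using rel_ent_support[OF S0 N] by metis
  \<comment> \<open>This compares \<open>g\<close> with the functional induced by \<open>K\<close>.
    It remains to show that \<open>r\<close> vanishes at \<open>?e ?S0\<close> and is nonnegative on
    all exponentials.\<close>
  define r where "r X = g X - rtr (X ** K)" for X
  have r: "linear r"
    unfolding r_def
    by (rule linearI)
       (simp_all add: linear_add[OF gh(1)] linear_scale[OF gh(1)] matrix_mult_add_left rtr_add
          matrix_mult_scaleR_left rtr_scaleR algebra_simps)
  have rel: "rel_ent (K + L) L = rtr (?e (K + L) ** K) - rtr (?e (K + L)) + rtr (?e L)" for L
    by (simp add: rel_ent_def)
  obtain C where C: "C \<ge> 0" "\<And>S. self_adjoint S \<Longrightarrow>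
     rel_ent S ?S0 \<le> C * rtr ((?e S - ?e ?S0) ** (?e S - ?e ?S0))"
    using rel_ent_le_square[OF S0] by metis
  \<comment> \<open>Replacing \<open>N\<close> by \<open>?S0\<close> in the second argument of the
    entropy changes it only by a constant and the term in \<open>K\<close>. The support inequality,
    an equality at \<open>?S0\<close>, therefore bounds the linear \<open>r\<close> by an expression
    quadratic in the increment.\<close>
  have quad: "r (?e S - ?e ?S0) \<le> C * rtr ((?e S - ?e ?S0) ** (?e S - ?e ?S0))" if S: "self_adjoint S" for S
  proof -
    have "rel_ent S N = rel_ent S ?S0 - rtr (?e ?S0) + rtr (?e N) + rtr (?e S ** K)"
      by (simp add: rel_ent_def matrix_mult_diff_right matrix_add_ldistrib rtr_diff rtr_add)
    moreover have "g (?e S) + h (?e N) \<le> rel_ent S N" by (rule gh(3)[OF S N])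
    moreover have "g (?e ?S0) + h (?e N) = rtr (?e ?S0 ** K) - rtr (?e ?S0) + rtr (?e N)"
      using gh(4) rel by simp
    ultimately have "r (?e S) - r (?e ?S0) \<le> rel_ent S ?S0" by (simp add: r_def)
    with C(2)[OF S] show ?thesis by (simp add: linear_diff[OF r])
  qed
  obtain a where a: "a > 0" "\<And>x. a * (norm x)\<^sup>2 \<le> x \<bullet> (?e ?S0 *v x)"
    using pos_eigenvalue_bounds[OF S0] by metis
  \<comment> \<open>A small multiple \<open>t\<close> of \<open>Q\<close> added to
    \<open>?e ?S0\<close> is still an exponential, so \<open>quad\<close> applies: its left side is
    of order \<open>t\<close>, its right side of order \<open>t^2\<close>, which excludes a positive
    slope.\<close>
  have r_nonpos: "r Q \<le> 0" if Q: "self_adjoint Q" and b: "b > 0" "\<And>x. - b * (norm x)\<^sup>2 \<le> x \<bullet> (Q *v x)"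
    for Q :: "complex^'d^'d" and b
  proof (rule ccontr)
    assume neg: "\<not> r Q \<le> 0"
    define D where "D = C * rtr (Q ** Q)"
    \<comment> \<open>The first bound keeps \<open>?e ?S0 + t *\<^sub>R Q\<close> positive definite,
      since \<open>t * b < a\<close>. The second makes \<open>t * D\<close> at most half of
      \<open>r Q\<close>.\<close>
    define t where "t = min (a / (2 * b)) (r Q / (2 * (\<bar>D\<bar> + 1)))"
    have t: "t > 0" using a(1) b(1) neg by (auto simp: t_def)
    have tb: "t * b < a"
    proof -
      have "t * b \<le> a / (2 * b) * b" using b(1) by (intro mult_right_mono) (auto simp: t_def)
      also have "\<dots> < a" using a(1) b(1) by simp
      finally show ?thesis .
    qed
    let ?P = "?e ?S0 + t *\<^sub>R Q"
    have P: "self_adjoint ?P" using Q S0 by (simp add: self_adjoint_add self_adjoint_scaleR)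
    have "x \<bullet> (?P *v x) > 0" if "x \<noteq> 0" for x
    proof -
      have "(t * b) * (norm x)\<^sup>2 < a * (norm x)\<^sup>2" using tb that by simp
      also have "\<dots> \<le> x \<bullet> (?e ?S0 *v x)" by (rule a(2))
      moreover have "t * (- b * (norm x)\<^sup>2) \<le> t * (x \<bullet> (Q *v x))"
        using b(2)[of x] t by (intro mult_left_mono) auto
      ultimately show ?thesis
        by (simp add: matrix_vector_mult_add_rdistrib matrix_vector_scaleR_left inner_add_right mult.assoc)
    qed
    hence "?e (mat_fun ln ?P) = ?P" by (rule mat_fun_ln_exp[OF P])
    hence "r (t *\<^sub>R Q) \<le> C * rtr ((t *\<^sub>R Q) ** (t *\<^sub>R Q))"
      using quad[of "mat_fun ln ?P"] P by simp
    hence "t * r Q \<le> t * (t * D)"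
      by (simp add: linear_scale[OF r] matrix_mult_scaleR_left matrix_mult_scaleR_right
          rtr_scaleR D_def mult_ac)
    hence "r Q \<le> t * D" using t by simp
    also have "\<dots> \<le> t * (\<bar>D\<bar> + 1)" using t by (intro mult_left_mono) auto
    also have "\<dots> \<le> (r Q / (2 * (\<bar>D\<bar> + 1))) * (\<bar>D\<bar> + 1)"
      by (intro mult_right_mono) (auto simp: t_def)
    also have "\<dots> = r Q / 2"
      using abs_ge_zero[of D] by (simp add: field_simps)
    finally show False using neg by simp
  qed
  \<comment> \<open>Apply \<open>r_nonpos\<close> to the negated exponential, whose quadratic form
    is bounded below by its largest eigenvalue with a minus sign.\<close>
  have r_nonneg: "r (?e S) \<ge> 0" if S: "self_adjoint S" for S
  proof -
    obtain b where b: "b > 0" "\<And>x. x \<bullet> (?e S *v x) \<le> b * (norm x)\<^sup>2"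
      using pos_eigenvalue_bounds[OF S] by metis
    have "r ((- 1) *\<^sub>R ?e S) \<le> 0"
      by (rule r_nonpos[of _ b])
         (use b S in \<open>simp_all only: self_adjoint_scaleR self_adjoint_mat_fun matrix_vector_scaleR_left\<close>, simp)
    thus ?thesis by (simp add: linear_neg[OF r])
  qed
  have "r (?e ?S0) \<le> 0"
  proof (rule r_nonpos[of _ 1])
    show "- 1 * (norm x)\<^sup>2 \<le> x \<bullet> (?e ?S0 *v x)" for x
      using a(2)[of x] mult_nonneg_nonneg[of a "(norm x)\<^sup>2"] a(1) zero_le_power2[of "norm x"] by linarith
  qed (use S0 in auto)
  with r_nonneg[OF S0] have r0: "r (?e ?S0) = 0" by simp
  \<comment> \<open>Since \<open>g\<close> dominates the term in \<open>K\<close> at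
    \<open>?e (K + L)\<close>, that term cancels from the support inequality and only the traces and
    \<open>h\<close> remain.\<close>
  define \<phi> where "\<phi> A = rtr A - h A" for A
  show ?thesis
  proof (rule that[of \<phi>])
    show "linear \<phi>"
      unfolding \<phi>_def using gh(2) linear_rtr by (rule linear_compose_sub[rotated])
    fix L :: "complex^'d^'d" assume L: "self_adjoint L"
    have KL: "self_adjoint (K + L)" using K L by (rule self_adjoint_add)
    have "g (?e (K + L)) + h (?e L) \<le> rtr (?e (K + L) ** K) - rtr (?e (K + L)) + rtr (?e L)"
      using gh(3)[OF KL L] rel by simp
    moreover have "g (?e (K + L)) \<ge> rtr (?e (K + L) ** K)" using r_nonneg[OF KL] by (simp add: r_def)
    ultimately show "rtr (?e (K + L)) \<le> \<phi> (?e L)" by (simp add: \<phi>_def)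
  next
    show "\<phi> (?e N) = rtr (?e ?S0)"
      using gh(4) rel[of N] r0 by (simp add: \<phi>_def r_def)
  qed
qed

section \<open>Measurability of spectral functions\<close>

lemma conj_real_diag_entry:
  "(U ** real_diag l ** cnj_transpose U) $ i $ j = (\<Sum>k\<in>UNIV. U $ i $ k * of_real (l k) * cnj (U $ j $ k))"
proof -
  have "(U ** real_diag l ** cnj_transpose U) $ i $ j = (\<Sum>k\<in>UNIV. (U ** real_diag l) $ i $ k * cnj (U $ j $ k))"
    by (simp add: matrix_matrix_mult_def[of "U ** real_diag l"] cnj_transpose_def)
  thus ?thesis by (simp add: matrix_mult_real_diag)
qed

text \<open>The eigenvectors of \<open>A\<close> stay fixed, so convergence at its finitely many
  eigenvalues suffices.\<close>

lemma tendsto_mat_fun: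
  assumes A: "self_adjoint A" and lim: "\<And>x. (\<lambda>m. p m x) \<longlonglongrightarrow> f x"
  shows "(\<lambda>m. mat_fun (p m) A) \<longlonglongrightarrow> mat_fun f A"
proof -
  obtain U l where U: "unitary_mat U" "A = U ** real_diag l ** cnj_transpose U"
    using A by (rule self_adjoint_spectral)
  show ?thesis
    unfolding U(2) mat_fun_eq[OF U(1)]
    by (intro vec_tendstoI) (simp only: conj_real_diag_entry comp_def, intro tendsto_intros lim)
qed

lemma borel_measurable_matrix_mult:
  fixes f g :: "'a \<Rightarrow> complex^'d^'d"
  assumes "f \<in> borel_measurable M" "g \<in> borel_measurable M"
  shows "(\<lambda>\<omega>. f \<omega> ** g \<omega>) \<in> borel_measurable M"
  by (rule borel_measurable_continuous_Pair[OF assms])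
     (intro continuous_on_matrix_mult continuous_on_fst continuous_on_snd continuous_on_id)

lemma borel_measurable_mat_fun_polynomial:
  fixes Z :: "'a \<Rightarrow> complex^'d^'d"
  assumes Z: "Z \<in> borel_measurable M" and sa: "\<And>\<omega>. \<omega> \<in> space M \<Longrightarrow> self_adjoint (Z \<omega>)"
  shows "real_polynomial_function p \<Longrightarrow> (\<lambda>\<omega>. mat_fun p (Z \<omega>)) \<in> borel_measurable M"
proof (induction p rule: real_polynomial_function.induct)
  case (linear p)
  then obtain c where p: "p = (\<lambda>x. x * c)" by (auto simp: real_bounded_linear)
  have "mat_fun p (Z \<omega>) = c *\<^sub>R Z \<omega>" if "\<omega> \<in> space M" for \<omega>
    using sa[OF that] by (simp add: p mat_fun_mult mat_fun_id mat_fun_const matrix_mult_scaleR_right)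
  thus ?case using Z by (simp cong: measurable_cong)
next
  case (const c)
  thus ?case using sa by (simp add: mat_fun_const cong: measurable_cong)
next
  case (add f g)
  thus ?case using sa by (simp add: mat_fun_add cong: measurable_cong)
next
  case (mult f g)
  thus ?case using sa borel_measurable_matrix_mult by (simp add: mat_fun_mult cong: measurable_cong)
qed

text \<open>Diagonalisations are picked by choice and need not depend measurably on the outcome.
  Polynomials avoid them, being built from sums and products of matrices, and a continuous
  \<open>f\<close> is a pointwise limit of polynomials.\<close>

lemma borel_measurable_mat_fun:
  fixes Z :: "'a \<Rightarrow> complex^'d^'d"
  assumes Z: "Z \<in> borel_measurable M" and sa: "\<And>\<omega>. \<omega> \<in> space M \<Longrightarrow> self_adjoint (Z \<omega>)"
    and f: "continuous_on UNIV f"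
  shows "(\<lambda>\<omega>. mat_fun f (Z \<omega>)) \<in> borel_measurable M"
proof -
  \<comment> \<open>The intervals grow while the error shrinks, so that every real number is
    eventually covered whatever the size of the spectrum.\<close>
  have "\<exists>p. real_polynomial_function p \<and> (\<forall>x\<in>{- real m..real m}. \<bar>f x - p x\<bar> < 1 / real (Suc m))" for m
    by (rule Stone_Weierstrass_real_polynomial_function[of "{- real m..real m}" f "1 / real (Suc m)"])
       (auto intro: continuous_on_subset[OF f])
  then obtain p where p: "\<And>m. real_polynomial_function (p m)"
    "\<And>m x. x \<in> {- real m..real m} \<Longrightarrow> \<bar>f x - p m x\<bar> < 1 / real (Suc m)"
    by metis
  have lim: "(\<lambda>m. p m x) \<longlonglongrightarrow> f x" for x
  proof (rule Lim_transform_eventually)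
    obtain m0 where m0: "\<bar>x\<bar> \<le> real m0" using real_arch_simple by blast
    have "(\<lambda>m. p m x - f x) \<longlonglongrightarrow> 0"
    proof (rule Lim_null_comparison)
      show "\<forall>\<^sub>F m in sequentially. norm (p m x - f x) \<le> 1 / real (Suc m)"
        using eventually_ge_at_top[of m0]
      proof eventually_elim
        case (elim m)
        hence "x \<in> {- real m..real m}" using m0 by auto
        from p(2)[OF this] show ?case by (simp add: abs_minus_commute)
      qed
      show "(\<lambda>m. 1 / real (Suc m)) \<longlonglongrightarrow> 0"
        using LIMSEQ_inverse_real_of_nat by (simp add: inverse_eq_divide)
    qed
    from tendsto_add[OF this tendsto_const[of "f x"]]
    show "(\<lambda>m. (p m x - f x) + f x) \<longlonglongrightarrow> f x" by simp
  qed simp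
  show ?thesis
  proof (rule borel_measurable_LIMSEQ_metric)
    show "(\<lambda>\<omega>. mat_fun (p m) (Z \<omega>)) \<in> borel_measurable M" for m
      by (rule borel_measurable_mat_fun_polynomial[OF Z sa p(1)])
    show "(\<lambda>m. mat_fun (p m) (Z \<omega>)) \<longlonglongrightarrow> mat_fun f (Z \<omega>)" if "\<omega> \<in> space M" for \<omega>
      by (rule tendsto_mat_fun[OF sa[OF that] lim])
  qed
qed

lemma borel_measurable_rtr:
  "f \<in> borel_measurable M \<Longrightarrow> (\<lambda>\<omega>. rtr (f \<omega>)) \<in> borel_measurable M"
  by (rule borel_measurable_continuous_on[where f = rtr]) (intro continuous_on_rtr continuous_on_id)

text \<open>A continuous map from all matrices onto the self-adjoint ones that fixes the latter.
  Composing with it makes spectral functions measurable on the whole matrix space, as independence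
  and product measures require.\<close>

definition herm_part :: "complex^'d^'d \<Rightarrow> complex^'d^'d" where
  "herm_part A = (1/2) *\<^sub>R (A + cnj_transpose A)"

lemma self_adjoint_herm_part [simp]: "self_adjoint (herm_part A)"
  by (simp add: self_adjoint_def herm_part_def adj_scaleR adj_add add.commute)

lemma herm_part_self_adjoint: "self_adjoint A \<Longrightarrow> herm_part A = A"
  by (simp add: self_adjoint_def herm_part_def scaleR_2[symmetric])

lemma borel_measurable_herm_part: "herm_part \<in> borel_measurable borel"
  unfolding herm_part_def
  by (intro borel_measurable_continuous_onI continuous_intros continuous_on_cnj_transpose)

lemma borel_measurable_mat_fun_herm_part:
  "continuous_on UNIV f \<Longrightarrow> (\<lambda>A. mat_fun f (herm_part A)) \<in> borel_measurable borel"
  by (rule borel_measurable_mat_fun[OF borel_measurable_herm_part]) auto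

section \<open>Expectations of random matrices\<close>

lemma bounded_linear_matrix_entry: "bounded_linear (\<lambda>A :: complex^'d^'d. A $ a $ b)"
  by (rule bounded_linear_compose[OF bounded_linear_vec_nth bounded_linear_vec_nth])

lemma integrable_matrixI:
  fixes X :: "'a \<Rightarrow> complex^'d^'d"
  assumes X: "X \<in> borel_measurable M" and int: "\<And>a b. integrable M (\<lambda>\<omega>. X \<omega> $ a $ b)"
  shows "integrable M X"
proof (rule Bochner_Integration.integrable_bound[OF _ X])
  show "integrable M (\<lambda>\<omega>. \<Sum>a\<in>UNIV. \<Sum>b\<in>UNIV. norm (X \<omega> $ a $ b))"
    by (intro Bochner_Integration.integrable_sum integrable_norm int)
  have "norm A \<le> (\<Sum>a\<in>UNIV. \<Sum>b\<in>UNIV. norm (A $ a $ b))" for A :: "complex^'d^'d"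
  proof -
    have "norm A \<le> (\<Sum>a\<in>UNIV. norm (A $ a))" by (simp add: norm_vec_def L2_set_le_sum)
    also have "\<dots> \<le> (\<Sum>a\<in>UNIV. \<Sum>b\<in>UNIV. norm (A $ a $ b))"
      by (intro sum_mono) (simp add: norm_vec_def[of "A $ _"] L2_set_le_sum)
    finally show ?thesis .
  qed
  thus "AE \<omega> in M. norm (X \<omega>) \<le> norm (\<Sum>a\<in>UNIV. \<Sum>b\<in>UNIV. norm (X \<omega> $ a $ b))"
    by (auto intro: order_trans[OF _ abs_ge_self])
qed

text \<open>Passing from entries to the Bochner integral lets bounded linear functionals be moved
  through expectations.\<close>

lemma mat_expectation_eq_integral:
  "integrable M X \<Longrightarrow> mat_expectation M X = integral\<^sup>L M X"
  by (simp add: mat_expectation_def vec_eq_iff integral_bounded_linear[OF bounded_linear_matrix_entry])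

lemma self_adjoint_integral:
  assumes int: "integrable M X" and sa: "\<And>\<omega>. \<omega> \<in> space M \<Longrightarrow> self_adjoint (X \<omega>)"
  shows "self_adjoint (integral\<^sup>L M X)"
proof -
  have lin: "bounded_linear (cnj_transpose :: complex^'d^'d \<Rightarrow> _)"
    unfolding linear_conv_bounded_linear[symmetric]
    by (rule linearI) (simp_all add: adj_add adj_scaleR)
  have "cnj_transpose (integral\<^sup>L M X) = (\<integral>\<omega>. cnj_transpose (X \<omega>) \<partial>M)"
    using integral_bounded_linear[OF lin int] by simp
  also have "\<dots> = integral\<^sup>L M X"
    using sa by (intro Bochner_Integration.integral_cong) (auto simp: self_adjoint_def)
  finally show ?thesis by (simp add: self_adjoint_def)
qed

lemma bounded_linear_quadratic_form: "bounded_linear (\<lambda>A :: complex^'d^'d. x \<bullet> (A *v x))"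
  unfolding linear_conv_bounded_linear[symmetric]
  by (rule linearI) (simp_all add: matrix_vector_mult_add_rdistrib matrix_vector_scaleR_left inner_add_right)

lemma rtr_exp_nonneg:
  assumes "self_adjoint A"
  shows "rtr (mat_fun exp A) \<ge> 0"
  using assms by (elim self_adjoint_spectral) (auto simp: mat_fun_eq rtr_conj intro!: sum_nonneg)

context prob_space
begin

text \<open>The quadratic form is positive at every outcome, and an almost surely positive function
  on a probability space has positive integral. This makes the logarithm of the mean
  meaningful.\<close>

lemma integral_mat_fun_exp_pos:
  fixes Z :: "'a \<Rightarrow> complex^'d^'d"
  assumes sa: "\<And>\<omega>. \<omega> \<in> space M \<Longrightarrow> self_adjoint (Z \<omega>)"
    and int: "integrable M (\<lambda>\<omega>. mat_fun exp (Z \<omega>))" and x: "x \<noteq> 0"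
  shows "0 < x \<bullet> (integral\<^sup>L M (\<lambda>\<omega>. mat_fun exp (Z \<omega>)) *v x)"
proof -
  let ?f = "\<lambda>\<omega>. x \<bullet> (mat_fun exp (Z \<omega>) *v x)"
  have pos: "?f \<omega> > 0" if \<omega>: "\<omega> \<in> space M" for \<omega>
  proof -
    obtain a where "a > 0" "\<And>x. a * (norm x)\<^sup>2 \<le> x \<bullet> (mat_fun exp (Z \<omega>) *v x)"
      using pos_eigenvalue_bounds[OF sa[OF \<omega>]] by metis
    moreover from this have "a * (norm x)\<^sup>2 > 0" using x by simp
    ultimately show ?thesis by (meson less_le_trans)
  qed
  have intf: "integrable M ?f"
    by (rule integrable_bounded_linear[OF bounded_linear_quadratic_form int])
  have eq: "integral\<^sup>L M ?f = x \<bullet> (integral\<^sup>L M (\<lambda>\<omega>. mat_fun exp (Z \<omega>)) *v x)"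
    by (rule integral_bounded_linear[OF bounded_linear_quadratic_form int])
  have "integral\<^sup>L M ?f \<noteq> 0"
  proof
    assume "integral\<^sup>L M ?f = 0"
    moreover have "AE \<omega> in M. 0 \<le> ?f \<omega>" using pos by (intro AE_I2 less_imp_le)
    ultimately have "AE \<omega> in M. ?f \<omega> = 0" using integral_nonneg_eq_0_iff_AE[OF intf] by blast
    hence "AE \<omega> in M. False"
      using AE_space by eventually_elim (use pos in force)
    thus False by (simp add: AE_False)
  qed
  moreover have "integral\<^sup>L M ?f \<ge> 0"
    using pos by (intro integral_nonneg_AE AE_I2 less_imp_le)
  ultimately show ?thesis unfolding eq by simp
qed

text \<open>Lieb's theorem and Jensen's inequality, together with $\log B \le B - 1$.\<close>
lemma nn_integral_rtr_exp_le:
  fixes Z :: "'a \<Rightarrow> complex^'d^'d"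
  assumes K: "self_adjoint K" and sa: "\<And>\<omega>. \<omega> \<in> space M \<Longrightarrow> self_adjoint (Z \<omega>)"
    and int: "integrable M (\<lambda>\<omega>. mat_fun exp (Z \<omega>))"
  shows "(\<integral>\<^sup>+ \<omega>. ennreal (rtr (mat_fun exp (K + Z \<omega>))) \<partial>M)
    \<le> ennreal (rtr (mat_fun exp (K + (integral\<^sup>L M (\<lambda>\<omega>. mat_fun exp (Z \<omega>)) - mat 1))))"
proof -
  define B where "B = integral\<^sup>L M (\<lambda>\<omega>. mat_fun exp (Z \<omega>))"
  define N where "N = mat_fun ln B"
  have B: "self_adjoint B" unfolding B_def using sa by (intro self_adjoint_integral int) simp
  hence N: "self_adjoint N" by (simp add: N_def)
  have expN: "mat_fun exp N = B"
    unfolding N_def using integral_mat_fun_exp_pos[OF sa int] by (intro mat_fun_ln_exp B) (simp add: B_def)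
  \<comment> \<open>The supporting functional is taken at the logarithm of the mean, so that
    integrating it gives the value at the mean exactly; this is the Jensen step.\<close>
  obtain \<phi> :: "complex^'d^'d \<Rightarrow> real" where \<phi>: "linear \<phi>"
    "\<And>L. self_adjoint L \<Longrightarrow> rtr (mat_fun exp (K + L)) \<le> \<phi> (mat_fun exp L)"
    "\<phi> (mat_fun exp N) = rtr (mat_fun exp (K + N))"
    using lieb_support[OF K N] by metis
  have bl: "bounded_linear \<phi>" using \<phi>(1) by (simp add: linear_conv_bounded_linear)
  have int\<phi>: "integrable M (\<lambda>\<omega>. \<phi> (mat_fun exp (Z \<omega>)))"
    by (rule integrable_bounded_linear[OF bl int])
  have "(\<integral>\<^sup>+ \<omega>. ennreal (rtr (mat_fun exp (K + Z \<omega>))) \<partial>M) \<le> (\<integral>\<^sup>+ \<omega>. ennreal (\<phi> (mat_fun exp (Z \<omega>))) \<partial>M)"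
    using \<phi>(2) sa by (intro nn_integral_mono ennreal_leI) auto
  also have "\<dots> = ennreal (\<integral>\<omega>. \<phi> (mat_fun exp (Z \<omega>)) \<partial>M)"
    using \<phi>(2) sa rtr_exp_nonneg K
    by (intro nn_integral_eq_integral[OF int\<phi>] AE_I2) (blast intro: order_trans self_adjoint_add)
  also have "(\<integral>\<omega>. \<phi> (mat_fun exp (Z \<omega>)) \<partial>M) = \<phi> B"
    unfolding B_def by (rule integral_bounded_linear[OF bl int])
  also have "\<phi> B = rtr (mat_fun exp (K + N))" using \<phi>(3) by (simp add: expN)
  also have "\<dots> \<le> rtr (mat_fun exp (K + (B - mat 1)))"
  proof (rule rtr_exp_mono)
    have "B - mat 1 = mat_fun (\<lambda>x. exp x + - 1) N"
      unfolding mat_fun_add[OF N] mat_fun_const[OF N] expN by simp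
    moreover have "psd (mat_fun (\<lambda>x. exp x + - 1) N - mat_fun (\<lambda>x. x) N)"
      by (rule psd_mat_fun_diff[OF N]) (use exp_ge_add_one_self in \<open>simp add: algebra_simps\<close>)
    ultimately show "psd (K + (B - mat 1) - (K + N))" by (simp add: mat_fun_id[OF N])
    show "self_adjoint (K + N)" by (intro self_adjoint_add K N)
    show "self_adjoint (K + (B - mat 1))" by (intro self_adjoint_add self_adjoint_diff K B self_adjoint_mat_1)
  qed
  finally show ?thesis by (simp add: B_def ennreal_leI)
qed

section \<open>Independent summands\<close>

lemma indep_vars_sum_vector:
  fixes X :: "'i \<Rightarrow> 'a \<Rightarrow> 'c :: {second_countable_topology, real_normed_vector}"
  assumes I: "finite I" "i \<notin> I" and indep: "indep_vars (\<lambda>_. borel) X (insert i I)"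
  shows "indep_var borel (\<lambda>\<omega>. \<Sum>i\<in>I. X i \<omega>) borel (X i)"
proof -
  have "indep_var (PiM I (\<lambda>_. borel)) (\<lambda>\<omega>. \<lambda>i\<in>I. X i \<omega>) (PiM {i} (\<lambda>_. borel)) (\<lambda>\<omega>. \<lambda>i\<in>{i}. X i \<omega>)"
    using I by (intro indep_var_restrict[OF indep]) auto
  from indep_var_compose[OF this, of "\<lambda>f. \<Sum>j\<in>I. f j" borel "\<lambda>f. f i" borel]
  show ?thesis by (simp add: comp_def)
qed

text \<open>By independence the joint law is a product, and Tonelli's theorem applies. The second
  outcome \<open>\<omega>'\<close> can then be averaged with \<open>\<omega>\<close> frozen.\<close>

lemma nn_integral_indep_var:
  assumes indep: "indep_var S X T Z" and f: "f \<in> borel_measurable (S \<Otimes>\<^sub>M T)"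
  shows "(\<integral>\<^sup>+ \<omega>. f (X \<omega>, Z \<omega>) \<partial>M) = (\<integral>\<^sup>+ \<omega>. \<integral>\<^sup>+ \<omega>'. f (X \<omega>, Z \<omega>') \<partial>M \<partial>M)"
proof -
  have X: "X \<in> measurable M S" and Z: "Z \<in> measurable M T"
    and eq: "distr M S X \<Otimes>\<^sub>M distr M T Z = distr M (S \<Otimes>\<^sub>M T) (\<lambda>\<omega>. (X \<omega>, Z \<omega>))"
    using indep by (auto simp: indep_var_distribution_eq)
  interpret Z: prob_space "distr M T Z" by (rule prob_space_distr[OF Z])
  have f': "f \<in> borel_measurable (distr M S X \<Otimes>\<^sub>M distr M T Z)"
    using f by (simp add: measurable_cong_sets[OF sets_pair_measure_cong[OF sets_distr sets_distr] refl])
  have "(\<integral>\<^sup>+ \<omega>. f (X \<omega>, Z \<omega>) \<partial>M) = integral\<^sup>N (distr M (S \<Otimes>\<^sub>M T) (\<lambda>\<omega>. (X \<omega>, Z \<omega>))) f"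
    using X Z f by (subst nn_integral_distr) auto
  also have "\<dots> = (\<integral>\<^sup>+ x. \<integral>\<^sup>+ z. f (x, z) \<partial>distr M T Z \<partial>distr M S X)"
    unfolding eq[symmetric] by (rule Z.nn_integral_fst[OF f', symmetric])
  also have "\<dots> = (\<integral>\<^sup>+ \<omega>. \<integral>\<^sup>+ z. f (X \<omega>, z) \<partial>distr M T Z \<partial>M)"
    by (intro nn_integral_distr X Z.borel_measurable_nn_integral_fst f')
  also have "\<dots> = (\<integral>\<^sup>+ \<omega>. \<integral>\<^sup>+ \<omega>'. f (X \<omega>, Z \<omega>') \<partial>M \<partial>M)"
    using measurable_space[OF X]
    by (intro nn_integral_cong nn_integral_distr Z) (auto intro: measurable_Pair2[OF f])
  finally show ?thesis .
qed

lemma nn_integral_rtr_exp_sum_le: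
  fixes Z :: "'i \<Rightarrow> 'a \<Rightarrow> complex^'d^'d"
  assumes "finite I" "indep_vars (\<lambda>_. borel) Z I"
    "\<And>i \<omega>. i \<in> I \<Longrightarrow> \<omega> \<in> space M \<Longrightarrow> self_adjoint (Z i \<omega>)"
    "\<And>i. i \<in> I \<Longrightarrow> integrable M (\<lambda>\<omega>. mat_fun exp (Z i \<omega>))"
    "self_adjoint H"
  shows "(\<integral>\<^sup>+ \<omega>. ennreal (rtr (mat_fun exp (H + (\<Sum>i\<in>I. Z i \<omega>)))) \<partial>M)
    \<le> ennreal (rtr (mat_fun exp (H + (\<Sum>i\<in>I. integral\<^sup>L M (\<lambda>\<omega>. mat_fun exp (Z i \<omega>)) - mat 1))))"
  using assms
proof (induction I arbitrary: H rule: finite_induct)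
  case empty
  thus ?case by (simp add: emeasure_space_1)
next
  case (insert k I)
  note Z = insert.prems(2) and int = insert.prems(3) and H = insert.prems(4)
  let ?S = "\<lambda>\<omega>. \<Sum>i\<in>I. Z i \<omega>"
  define B where "B = integral\<^sup>L M (\<lambda>\<omega>. mat_fun exp (Z k \<omega>)) - mat 1"
  have S: "self_adjoint (?S \<omega>)" if "\<omega> \<in> space M" for \<omega>
    using Z that by (intro self_adjoint_sum) auto
  have B: "self_adjoint B"
    unfolding B_def using Z int
    by (intro self_adjoint_diff self_adjoint_integral self_adjoint_mat_1) auto
  define f where "f = (\<lambda>(x, z). ennreal (rtr (mat_fun exp (herm_part (H + x + z)))))"
  have f: "f \<in> borel_measurable (borel \<Otimes>\<^sub>M borel)"
  proof -
    have "(\<lambda>p. herm_part (H + fst p + snd p)) \<in> borel_measurable (borel \<Otimes>\<^sub>M borel)"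
      by (rule measurable_compose[OF _ borel_measurable_herm_part]) measurable
    hence "(\<lambda>p. mat_fun exp (herm_part (H + fst p + snd p))) \<in> borel_measurable (borel \<Otimes>\<^sub>M borel)"
      by (rule borel_measurable_mat_fun) (auto intro: continuous_intros)
    thus ?thesis unfolding f_def split_beta
      by (intro measurable_ennreal borel_measurable_rtr measurable_compose[OF _ measurable_ennreal])
  qed
  have "(\<integral>\<^sup>+ \<omega>. ennreal (rtr (mat_fun exp (H + (\<Sum>i\<in>insert k I. Z i \<omega>)))) \<partial>M) = (\<integral>\<^sup>+ \<omega>. f (?S \<omega>, Z k \<omega>) \<partial>M)"
    using insert.hyps Z S H
    by (intro nn_integral_cong)
       (simp add: f_def add_ac herm_part_self_adjoint self_adjoint_add)
  also have "\<dots> = (\<integral>\<^sup>+ \<omega>. \<integral>\<^sup>+ \<omega>'. f (?S \<omega>, Z k \<omega>') \<partial>M \<partial>M)"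
    by (rule nn_integral_indep_var[OF indep_vars_sum_vector[OF insert.hyps insert.prems(1)] f])
  also have "\<dots> \<le> (\<integral>\<^sup>+ \<omega>. ennreal (rtr (mat_fun exp ((H + ?S \<omega>) + B))) \<partial>M)"
  proof (rule nn_integral_mono)
    fix \<omega> assume \<omega>: "\<omega> \<in> space M"
    have HS: "self_adjoint (H + ?S \<omega>)" using S[OF \<omega>] H by (simp add: self_adjoint_add)
    have "(\<integral>\<^sup>+ \<omega>'. f (?S \<omega>, Z k \<omega>') \<partial>M) = (\<integral>\<^sup>+ \<omega>'. ennreal (rtr (mat_fun exp ((H + ?S \<omega>) + Z k \<omega>'))) \<partial>M)"
      using Z HS by (intro nn_integral_cong) (simp add: f_def herm_part_self_adjoint self_adjoint_add)
    also have "\<dots> \<le> ennreal (rtr (mat_fun exp ((H + ?S \<omega>) + B)))"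
      unfolding B_def using Z int by (intro nn_integral_rtr_exp_le HS) auto
    finally show "(\<integral>\<^sup>+ \<omega>'. f (?S \<omega>, Z k \<omega>') \<partial>M) \<le> ennreal (rtr (mat_fun exp ((H + ?S \<omega>) + B)))" .
  qed
  also have "\<dots> = (\<integral>\<^sup>+ \<omega>. ennreal (rtr (mat_fun exp ((H + B) + ?S \<omega>))) \<partial>M)"
    by (simp add: add_ac)
  also have "\<dots> \<le> ennreal (rtr (mat_fun exp ((H + B) + (\<Sum>i\<in>I. integral\<^sup>L M (\<lambda>\<omega>. mat_fun exp (Z i \<omega>)) - mat 1))))"
    using Z int H B indep_vars_subset[OF insert.prems(1)]
    by (intro insert.IH) (auto simp: self_adjoint_add)
  also have "(H + B) + (\<Sum>i\<in>I. integral\<^sup>L M (\<lambda>\<omega>. mat_fun exp (Z i \<omega>)) - mat 1) =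
      H + (\<Sum>i\<in>insert k I. integral\<^sup>L M (\<lambda>\<omega>. mat_fun exp (Z i \<omega>)) - mat 1)"
    using insert.hyps by (simp add: B_def add_ac)
  finally show ?case .
qed

end

section \<open>Deviation bounds\<close>

lemma bounded_linear_matrix_vector_mult_complex: "bounded_linear ((*v) (A :: complex^'d^'d))"
  using linear_matrix_vector_mult_complex by (simp add: linear_conv_bounded_linear)

lemma op_norm_triangle: "op_norm (A + B) \<le> op_norm A + op_norm B"
  unfolding op_norm_def matrix_vector_mult_add_rdistrib
  by (rule onorm_triangle) (rule bounded_linear_matrix_vector_mult_complex)+

lemma op_norm_scaleR: "op_norm (c *\<^sub>R A) = \<bar>c\<bar> * op_norm A"
  unfolding op_norm_def matrix_vector_scaleR_left
  by (rule onorm_scaleR) (rule bounded_linear_matrix_vector_mult_complex)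

lemma op_norm_diff_triangle: "op_norm (A - C) \<le> op_norm (A - B) + op_norm (B - C)"
  using op_norm_triangle[of "A - B" "B - C"] by simp

lemma op_norm_diff_commute: "op_norm (A - B) = op_norm (B - A)"
  using op_norm_scaleR[of "- 1" "A - B"] by simp

lemma quadratic_form_le_op_norm: "x \<bullet> (A *v x) \<le> op_norm A * (norm x)\<^sup>2"
proof -
  have "x \<bullet> (A *v x) \<le> norm x * norm (A *v x)" by (rule norm_cauchy_schwarz)
  also have "\<dots> \<le> norm x * (op_norm A * norm x)"
    unfolding op_norm_def
    by (intro mult_left_mono onorm bounded_linear_matrix_vector_mult_complex) simp
  finally show ?thesis by (simp add: power2_eq_square mult_ac)
qed

text \<open>The witness is a unit eigenvector for an eigenvalue of largest modulus. That modulus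
  bounds the operator norm because \<open>A ** A\<close> has the squared eigenvalues.\<close>

lemma op_norm_witness:
  fixes A :: "complex^'d^'d"
  assumes A: "self_adjoint A"
  obtains x where "norm x = 1" "op_norm A \<le> \<bar>x \<bullet> (A *v x)\<bar>"
proof -
  obtain U l where U: "unitary_mat U" "A = U ** real_diag l ** cnj_transpose U"
    using A by (rule self_adjoint_spectral)
  have "Max (range (\<lambda>j. \<bar>l j\<bar>)) \<in> range (\<lambda>j. \<bar>l j\<bar>)" by (rule Max_in) auto
  then obtain i where "Max (range (\<lambda>j. \<bar>l j\<bar>)) = \<bar>l i\<bar>" by (rule rangeE)
  hence i: "\<bar>l j\<bar> \<le> \<bar>l i\<bar>" for j
    by (metis Max_ge finite finite_imageI rangeI)
  have "norm (A *v x) \<le> \<bar>l i\<bar> * norm x" for x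
  proof (rule power2_le_imp_le)
    have "(norm (A *v x))\<^sup>2 = x \<bullet> ((A ** A) *v x)"
      using A inner_adj[of x A "A *v x"]
      by (simp add: power2_norm_eq_inner self_adjoint_def matrix_vector_mul_assoc)
    also have "A ** A = mat_fun (\<lambda>t. t * t) A"
      by (simp add: mat_fun_mult[OF A] mat_fun_id[OF A])
    also have "x \<bullet> (mat_fun (\<lambda>t. t * t) A *v x)
        = (\<Sum>j\<in>UNIV. (l j)\<^sup>2 * (norm ((cnj_transpose U *v x) $ j))\<^sup>2)"
      unfolding U(2) mat_fun_eq[OF U(1)] inner_conj by (simp add: power2_eq_square)
    also have "\<dots> \<le> (\<Sum>j\<in>UNIV. (l i)\<^sup>2 * (norm ((cnj_transpose U *v x) $ j))\<^sup>2)"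
      by (intro sum_mono mult_right_mono) (use i in \<open>auto simp: abs_le_square_iff\<close>)
    also have "\<dots> = (\<bar>l i\<bar> * norm x)\<^sup>2"
      by (simp add: sum_distrib_left[symmetric] norm_unitary_mult[OF U(1)] power_mult_distrib)
    finally show "(norm (A *v x))\<^sup>2 \<le> (\<bar>l i\<bar> * norm x)\<^sup>2" .
  qed simp
  hence le: "op_norm A \<le> \<bar>l i\<bar>" unfolding op_norm_def by (intro onorm_le)
  let ?e = "axis i 1 :: complex^'d"
  have Ue: "cnj_transpose U *v (U *v ?e) = ?e"
    by (simp add: matrix_vector_mul_assoc unitary_mat_cancel[OF U(1)])
  have "(norm (U *v ?e))\<^sup>2 = 1"
    unfolding norm_unitary_mult[OF U(1), symmetric] Ue
    by (simp add: axis_def if_distrib[of norm] if_distrib[of "\<lambda>x. x^2"] cong: if_cong)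
  hence "norm (U *v ?e) = 1" by (simp add: power2_eq_1_iff) (metis norm_ge_zero not_one_le_zero neg_0_le_iff_le)
  moreover have "(U *v ?e) \<bullet> (A *v (U *v ?e)) = l i"
    unfolding U(2) inner_conj Ue
    by (simp add: axis_def if_distrib[of norm] if_distrib[of "\<lambda>x. x^2"] if_distrib[of "\<lambda>x. _ * x"] cong: if_cong)
  ultimately show ?thesis using le that by metis
qed

text \<open>At a unit vector the quadratic form is a weighted average of eigenvalues, so some
  eigenvalue is at least \<open>s\<close>. The trace exponential dominates the exponential of each
  eigenvalue.\<close>

lemma exp_le_rtr_exp:
  assumes S: "self_adjoint S" and x: "norm x = 1" "s \<le> x \<bullet> (S *v x)"
  shows "exp s \<le> rtr (mat_fun exp S)"
proof -
  obtain U l where U: "unitary_mat U" "S = U ** real_diag l ** cnj_transpose U"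
    using S by (rule self_adjoint_spectral)
  let ?y = "\<lambda>i. (norm ((cnj_transpose U *v x) $ i))\<^sup>2"
  have "\<exists>i. s \<le> l i"
  proof (rule ccontr)
    assume "\<nexists>i. s \<le> l i"
    hence l: "l i < s" for i by (simp add: not_le)
    have y: "(\<Sum>i\<in>UNIV. ?y i) = 1" using norm_unitary_mult[OF U(1), of x] x by simp
    then obtain k where k: "?y k > 0"
      by (metis (no_types, lifting) less_eq_real_def sum.neutral zero_le_power2 zero_neq_one)
    have "(\<Sum>i\<in>UNIV. l i * ?y i) < (\<Sum>i\<in>UNIV. s * ?y i)"
    proof (rule sum_strict_mono_ex1)
      show "\<forall>i\<in>UNIV. l i * ?y i \<le> s * ?y i" using l by (intro ballI mult_right_mono) (auto intro: less_imp_le)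
      show "\<exists>i\<in>UNIV. l i * ?y i < s * ?y i" by (rule bexI[where x = k], rule mult_strict_right_mono[OF l k]) simp
    qed simp
    also have "\<dots> = s" by (simp only: sum_distrib_left[symmetric] y mult_1_right)
    finally show False using x(2) unfolding U(2) inner_conj by simp
  qed
  then obtain i where "s \<le> l i" ..
  hence "exp s \<le> exp (l i)" by simp
  also have "\<dots> \<le> (\<Sum>i\<in>UNIV. exp (l i))" by (rule member_le_sum) auto
  also have "\<dots> = rtr (mat_fun exp S)" by (simp add: U mat_fun_eq rtr_conj)
  finally show ?thesis .
qed

lemma mat_fun_exp_scaleR_mat_1: "mat_fun exp (c *\<^sub>R mat 1 :: complex^'d^'d) = exp c *\<^sub>R mat 1"
proof -
  have "mat_fun exp (c *\<^sub>R mat 1 :: complex^'d^'d) = mat_fun exp (mat_fun (\<lambda>_. c) 0)"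
    by (simp add: mat_fun_const)
  also have "\<dots> = exp c *\<^sub>R mat 1" 
    unfolding mat_fun_comp[OF self_adjoint_0] comp_def by (rule mat_fun_const[OF self_adjoint_0])
  finally show ?thesis .
qed

lemma rtr_mat_1: "rtr (mat 1 :: complex^'d^'d) = real CARD('d)"
  by (simp add: rtr_def trace_def mat_def)

lemma one_plus_quadratic_pos: "1 + x + x\<^sup>2 / 2 > (0 :: real)"
proof -
  have "1 + x + x\<^sup>2 / 2 = ((x + 1)\<^sup>2 + 1) / 2" by (simp add: power2_eq_square field_simps)
  also have "\<dots> > 0" by (intro divide_pos_pos add_nonneg_pos) auto
  finally show ?thesis .
qed

text \<open>Both tails are covered by the sign of \<open>c\<close>: with \<open>c = \<theta>\<close>
  it majorises \<open>\<psi> (\<theta> * x)\<close>, with \<open>c = - \<theta>\<close> it majorises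
  \<open>- \<psi> (\<theta> * x)\<close>.\<close>

abbreviation ln_quadratic :: "real \<Rightarrow> real \<Rightarrow> real" where
  "ln_quadratic c x \<equiv> ln (1 + c * x + (c * x)\<^sup>2 / 2)"

text \<open>The exponential is a quadratic polynomial in \<open>A\<close>, so its expectation
  involves only the first two moments.\<close>

lemma exp_mat_fun_ln_quadratic:
  assumes A: "self_adjoint A"
  shows "mat_fun exp (mat_fun (ln_quadratic c) A) = mat 1 + c *\<^sub>R A + (c\<^sup>2 / 2) *\<^sub>R (A ** A)"
proof -
  have "mat_fun exp (mat_fun (ln_quadratic c) A) = mat_fun (\<lambda>x. 1 + c * x + (c\<^sup>2 / 2) * (x * x)) A"
    by (simp add: mat_fun_comp[OF A] comp_def one_plus_quadratic_pos) (simp add: power2_eq_square field_simps)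
  also have "\<dots> = mat 1 + c *\<^sub>R A + (c\<^sup>2 / 2) *\<^sub>R (A ** A)"
    by (simp only: mat_fun_add[OF A] mat_fun_mult[OF A] mat_fun_const[OF A] mat_fun_id[OF A]
        matrix_mult_scaleR_left matrix_mul_lid scaleR_one)
  finally show ?thesis .
qed

section \<open>Second moments and tail bounds\<close>

context prob_space
begin

lemma integrable_of_square_integrable:
  fixes f :: "'a \<Rightarrow> complex"
  assumes f: "f \<in> borel_measurable M" and "integrable M (\<lambda>\<omega>. (norm (f \<omega>))\<^sup>2)"
  shows "integrable M f"
proof (rule Bochner_Integration.integrable_bound[OF _ f])
  show "integrable M (\<lambda>\<omega>. 1 + (norm (f \<omega>))\<^sup>2)" using assms by simp
  have "x \<le> 1 + x\<^sup>2" for x :: real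
  proof -
    have "0 \<le> (x - 1)\<^sup>2 + (x\<^sup>2 + 1)" by simp
    thus ?thesis unfolding power2_diff by simp
  qed
  thus "AE \<omega> in M. norm (f \<omega>) \<le> norm (1 + (norm (f \<omega>))\<^sup>2)"
    by (auto intro: order_trans[OF _ abs_ge_self])
qed

lemma integrable_mult_of_square_integrable:
  fixes f g :: "'a \<Rightarrow> complex"
  assumes f: "f \<in> borel_measurable M" "integrable M (\<lambda>\<omega>. (norm (f \<omega>))\<^sup>2)"
    and g: "g \<in> borel_measurable M" "integrable M (\<lambda>\<omega>. (norm (g \<omega>))\<^sup>2)"
  shows "integrable M (\<lambda>\<omega>. f \<omega> * g \<omega>)"
proof (rule Bochner_Integration.integrable_bound)
  show "integrable M (\<lambda>\<omega>. (norm (f \<omega>))\<^sup>2 + (norm (g \<omega>))\<^sup>2)" using f g by simp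
  show "(\<lambda>\<omega>. f \<omega> * g \<omega>) \<in> borel_measurable M" using f g by simp
  have "x * y \<le> x\<^sup>2 + y\<^sup>2" for x y :: real
    using zero_le_power2[of "x - y"] zero_le_power2[of x] zero_le_power2[of y]
    unfolding power2_diff by linarith
  thus "AE \<omega> in M. norm (f \<omega> * g \<omega>) \<le> norm ((norm (f \<omega>))\<^sup>2 + (norm (g \<omega>))\<^sup>2)"
    by (auto simp: norm_mult)
qed

lemma integrable_matrix_of_square_integrable:
  fixes X :: "'a \<Rightarrow> complex^'d^'d"
  assumes X: "X \<in> borel_measurable M" and sq: "\<And>a b. integrable M (\<lambda>\<omega>. (norm (X \<omega> $ a $ b))\<^sup>2)"
  shows "integrable M X" "integrable M (\<lambda>\<omega>. X \<omega> ** X \<omega>)"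
proof -
  have entry: "(\<lambda>\<omega>. X \<omega> $ a $ b) \<in> borel_measurable M" for a b
    by (rule borel_measurable_continuous_on[OF _ X, where f = "\<lambda>A. A $ a $ b"])
       (rule linear_continuous_on[OF bounded_linear_matrix_entry])
  show "integrable M X"
    by (intro integrable_matrixI X integrable_of_square_integrable entry sq)
  show "integrable M (\<lambda>\<omega>. X \<omega> ** X \<omega>)"
  proof (rule integrable_matrixI[OF borel_measurable_matrix_mult[OF X X]])
    fix a b
    show "integrable M (\<lambda>\<omega>. (X \<omega> ** X \<omega>) $ a $ b)"
      unfolding matrix_matrix_mult_def vec_lambda_beta
      by (intro Bochner_Integration.integrable_sum integrable_mult_of_square_integrable entry sq)
  qed
qed

text \<open>This is the matrix Laplace transform method: Markov's inequality for the trace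
  exponential. The centring term enters as \<open>H\<close> and cancels the first moments, so only
  half of \<open>c^2\<close> times the variance matrix is left, which is at most a multiple of the
  identity.\<close>

lemma prob_rtr_exp_ge:
  fixes Y :: "'i \<Rightarrow> 'a \<Rightarrow> complex^'d^'d" and c r :: real
  assumes fin: "finite I" and indep: "indep_vars (\<lambda>_. borel) Y I"
    and sa: "\<And>i \<omega>. i \<in> I \<Longrightarrow> \<omega> \<in> space M \<Longrightarrow> self_adjoint (Y i \<omega>)"
    and sq: "\<And>i a b. i \<in> I \<Longrightarrow> integrable M (\<lambda>\<omega>. (norm (Y i \<omega> $ a $ b))\<^sup>2)"
    and var: "op_norm (\<Sum>i\<in>I. mat_expectation M (\<lambda>\<omega>. Y i \<omega> ** Y i \<omega>)) \<le> \<sigma>\<^sup>2"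
  defines "S \<equiv> \<lambda>\<omega>. (\<Sum>i\<in>I. mat_fun (ln_quadratic c) (Y i \<omega>)) - c *\<^sub>R (\<Sum>i\<in>I. mat_expectation M (Y i))"
  shows "{\<omega> \<in> space M. exp r \<le> rtr (mat_fun exp (S \<omega>))} \<in> sets M" (is "?E \<in> _")
    and "prob {\<omega> \<in> space M. exp r \<le> rtr (mat_fun exp (S \<omega>))} \<le> real CARD('d) * exp (c\<^sup>2 * \<sigma>\<^sup>2 / 2 - r)"
proof -
  \<comment> \<open>Each \<open>Z i\<close> is a measurable function of \<open>Y i\<close> on all
    matrices, so independence carries over.\<close>
  define Z where "Z i \<omega> = mat_fun (ln_quadratic c) (herm_part (Y i \<omega>))" for i \<omega>
  have Z_eq: "Z i \<omega> = mat_fun (ln_quadratic c) (Y i \<omega>)" if "i \<in> I" "\<omega> \<in> space M" for i \<omega>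
    using sa[OF that] by (simp add: Z_def herm_part_self_adjoint)
  have Z_sa: "self_adjoint (Z i \<omega>)" for i \<omega> by (simp add: Z_def)
  have "(\<lambda>A. mat_fun (ln_quadratic c) (herm_part A)) \<in> borel_measurable borel"
    by (rule borel_measurable_mat_fun_herm_part)
       (auto intro!: continuous_intros simp: one_plus_quadratic_pos[THEN less_imp_neq, symmetric])
  hence Z_indep: "indep_vars (\<lambda>_. borel) Z I"
    unfolding Z_def by (intro indep_vars_compose2[OF indep])
  have Y_meas: "Y i \<in> borel_measurable M" if "i \<in> I" for i
    using indep that by (auto simp: indep_vars_def)
  have Z_meas: "Z i \<in> borel_measurable M" if "i \<in> I" for i
    using Z_indep that by (auto simp: indep_vars_def)
  have int: "integrable M (Y i)" "integrable M (\<lambda>\<omega>. Y i \<omega> ** Y i \<omega>)" if "i \<in> I" for i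
    using integrable_matrix_of_square_integrable[OF Y_meas[OF that] sq[OF that]] by auto
  define EY where "EY = (\<Sum>i\<in>I. mat_expectation M (Y i))"
  define V where "V = (\<Sum>i\<in>I. mat_expectation M (\<lambda>\<omega>. Y i \<omega> ** Y i \<omega>))"
  have EY: "self_adjoint EY"
    unfolding EY_def using int sa
    by (intro self_adjoint_sum) (simp add: mat_expectation_eq_integral self_adjoint_integral)
  have V: "self_adjoint V"
    unfolding V_def using int sa
    by (intro self_adjoint_sum) (simp add: mat_expectation_eq_integral self_adjoint_integral self_adjoint_square)
  have expZ: "mat_fun exp (Z i \<omega>) = mat 1 + c *\<^sub>R Y i \<omega> + (c\<^sup>2 / 2) *\<^sub>R (Y i \<omega> ** Y i \<omega>)"
    if "i \<in> I" "\<omega> \<in> space M" for i \<omega>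
    using that sa by (simp add: Z_eq exp_mat_fun_ln_quadratic)
  have int_exp: "integrable M (\<lambda>\<omega>. mat_fun exp (Z i \<omega>))" if "i \<in> I" for i
    using that int[OF that] by (simp add: expZ cong: Bochner_Integration.integrable_cong)
  have "integral\<^sup>L M (\<lambda>\<omega>. mat_fun exp (Z i \<omega>)) - mat 1
      = c *\<^sub>R mat_expectation M (Y i) + (c\<^sup>2 / 2) *\<^sub>R mat_expectation M (\<lambda>\<omega>. Y i \<omega> ** Y i \<omega>)"
    if "i \<in> I" for i
    using that int[OF that]
    by (simp add: expZ mat_expectation_eq_integral prob_space cong: Bochner_Integration.integral_cong)
  hence EZ: "(\<Sum>i\<in>I. integral\<^sup>L M (\<lambda>\<omega>. mat_fun exp (Z i \<omega>)) - mat 1) = c *\<^sub>R EY + (c\<^sup>2 / 2) *\<^sub>R V"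
    by (simp add: EY_def V_def sum.distrib scaleR_sum_right)
  have S_eq: "S \<omega> = - c *\<^sub>R EY + (\<Sum>i\<in>I. Z i \<omega>)" if "\<omega> \<in> space M" for \<omega>
    using that by (simp add: S_def EY_def Z_eq)
  have S_sa: "self_adjoint (S \<omega>)" if "\<omega> \<in> space M" for \<omega>
    unfolding S_eq[OF that] by (intro self_adjoint_add self_adjoint_scaleR self_adjoint_sum EY Z_sa)
  have S_meas: "S \<in> borel_measurable M"
    using Z_meas by (simp add: S_eq cong: measurable_cong)
  have meas: "(\<lambda>\<omega>. rtr (mat_fun exp (S \<omega>))) \<in> borel_measurable M"
    by (intro borel_measurable_rtr borel_measurable_mat_fun S_meas S_sa continuous_intros)
  thus sets: "?E \<in> sets M" by measurable
  have "(\<integral>\<^sup>+ \<omega>. ennreal (rtr (mat_fun exp (S \<omega>))) \<partial>M)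
      = (\<integral>\<^sup>+ \<omega>. ennreal (rtr (mat_fun exp (- c *\<^sub>R EY + (\<Sum>i\<in>I. Z i \<omega>)))) \<partial>M)"
    by (intro nn_integral_cong) (simp add: S_eq)
  also have "\<dots> \<le> ennreal (rtr (mat_fun exp (- c *\<^sub>R EY + (c *\<^sub>R EY + (c\<^sup>2 / 2) *\<^sub>R V))))"
    unfolding EZ[symmetric]
    by (intro nn_integral_rtr_exp_sum_le fin Z_indep Z_sa int_exp self_adjoint_scaleR EY)
  also have "\<dots> \<le> ennreal (rtr (mat_fun exp ((c\<^sup>2 * \<sigma>\<^sup>2 / 2) *\<^sub>R mat 1 :: complex^'d^'d)))"
  proof (intro ennreal_leI rtr_exp_mono)
    have "(c\<^sup>2 / 2) * (x \<bullet> (V *v x)) \<le> c\<^sup>2 * \<sigma>\<^sup>2 / 2 * (norm x)\<^sup>2" for x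
    proof -
      have "x \<bullet> (V *v x) \<le> op_norm V * (norm x)\<^sup>2" by (rule quadratic_form_le_op_norm)
      also have "\<dots> \<le> \<sigma>\<^sup>2 * (norm x)\<^sup>2" using var by (intro mult_right_mono) (auto simp: V_def)
      finally have "(c\<^sup>2 / 2) * (x \<bullet> (V *v x)) \<le> (c\<^sup>2 / 2) * (\<sigma>\<^sup>2 * (norm x)\<^sup>2)"
        by (intro mult_left_mono) auto
      thus ?thesis by (simp add: mult_ac)
    qed
    thus "psd ((c\<^sup>2 * \<sigma>\<^sup>2 / 2) *\<^sub>R mat 1 - (- c *\<^sub>R EY + (c *\<^sub>R EY + (c\<^sup>2 / 2) *\<^sub>R V)))"
      by (simp add: psd_def matrix_vector_mult_diff_rdistrib matrix_vector_scaleR_left inner_diff_right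
          power2_norm_eq_inner)
  qed (intro self_adjoint_add self_adjoint_scaleR EY V self_adjoint_mat_1)+
  also have "\<dots> = ennreal (real CARD('d) * exp (c\<^sup>2 * \<sigma>\<^sup>2 / 2))"
    by (simp add: mat_fun_exp_scaleR_mat_1 rtr_scaleR rtr_mat_1 mult.commute)
  finally have int_le: "(\<integral>\<^sup>+ \<omega>. ennreal (rtr (mat_fun exp (S \<omega>))) \<partial>M) \<le> ennreal (real CARD('d) * exp (c\<^sup>2 * \<sigma>\<^sup>2 / 2))" .
  have E_eq: "?E = {\<omega> \<in> space M. 1 \<le> ennreal (exp (- r)) * ennreal (rtr (mat_fun exp (S \<omega>)))}"
  proof -
    have "exp r \<le> y \<longleftrightarrow> 1 \<le> exp (- r) * y" for y :: real
      by (simp add: exp_minus field_simps)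
    thus ?thesis by (auto simp: ennreal_mult'[symmetric] ennreal_1[symmetric] ennreal_le_iff2 simp del: ennreal_1)
  qed
  have "emeasure M ?E \<le> ennreal (exp (- r)) * (\<integral>\<^sup>+ \<omega>. ennreal (rtr (mat_fun exp (S \<omega>))) * indicator (space M) \<omega> \<partial>M)"
    unfolding E_eq using meas by (intro nn_integral_Markov_inequality) auto
  also have "(\<integral>\<^sup>+ \<omega>. ennreal (rtr (mat_fun exp (S \<omega>))) * indicator (space M) \<omega> \<partial>M) = (\<integral>\<^sup>+ \<omega>. ennreal (rtr (mat_fun exp (S \<omega>))) \<partial>M)"
    by (intro nn_integral_cong) simp
  also have "ennreal (exp (- r)) * (\<integral>\<^sup>+ \<omega>. ennreal (rtr (mat_fun exp (S \<omega>))) \<partial>M)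
      \<le> ennreal (exp (- r)) * ennreal (real CARD('d) * exp (c\<^sup>2 * \<sigma>\<^sup>2 / 2))"
    by (intro mult_left_mono int_le) simp
  also have "\<dots> = ennreal (real CARD('d) * exp (c\<^sup>2 * \<sigma>\<^sup>2 / 2 - r))"
    by (simp add: ennreal_mult'[symmetric] mult.left_commute[of "exp _"] mult_exp_exp)
  finally show "prob ?E \<le> real CARD('d) * exp (c\<^sup>2 * \<sigma>\<^sup>2 / 2 - r)"
    by (simp add: emeasure_eq_measure)
qed

text \<open>
  As \<open>\<psi>\<close> is not assumed to be measurable, neither is the deviation event; it is covered by
  events expressed through the continuous majorants of $\pm\psi$.
\<close>
lemma truncated_mean_deviation:
  fixes Y :: "'i \<Rightarrow> 'a \<Rightarrow> complex^'d^'d"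
  assumes fin: "finite I" and indep: "indep_vars (\<lambda>_. borel) Y I"
    and sa: "\<And>i \<omega>. i \<in> I \<Longrightarrow> \<omega> \<in> space M \<Longrightarrow> self_adjoint (Y i \<omega>)"
    and sq: "\<And>i a b. i \<in> I \<Longrightarrow> integrable M (\<lambda>\<omega>. (norm (Y i \<omega> $ a $ b))\<^sup>2)"
    and var: "op_norm (\<Sum>i\<in>I. mat_expectation M (\<lambda>\<omega>. Y i \<omega> ** Y i \<omega>)) \<le> \<sigma>\<^sup>2"
    and lower: "\<And>x. - ln (1 - x + x\<^sup>2 / 2) \<le> \<psi> x" and upper: "\<And>x. \<psi> x \<le> ln (1 + x + x\<^sup>2 / 2)"
  obtains E where "E \<in> sets M" "prob E \<le> 2 * real CARD('d) * exp (\<theta>\<^sup>2 * \<sigma>\<^sup>2 / 2 - r)"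
    "{\<omega> \<in> space M. r \<le> op_norm ((\<Sum>i\<in>I. mat_fun \<psi> (\<theta> *\<^sub>R Y i \<omega>)) - \<theta> *\<^sub>R (\<Sum>i\<in>I. mat_expectation M (Y i)))} \<subseteq> E"
proof -
  define EY where "EY = (\<Sum>i\<in>I. mat_expectation M (Y i))"
  define S where "S c \<omega> = (\<Sum>i\<in>I. mat_fun (ln_quadratic c) (Y i \<omega>)) - c *\<^sub>R EY" for c \<omega>
  define D where "D \<omega> = (\<Sum>i\<in>I. mat_fun \<psi> (\<theta> *\<^sub>R Y i \<omega>)) - \<theta> *\<^sub>R EY" for \<omega>
  define E where "E c = {\<omega> \<in> space M. exp r \<le> rtr (mat_fun exp (S c \<omega>))}" for c
  have E: "E c \<in> sets M" "prob (E c) \<le> real CARD('d) * exp (c\<^sup>2 * \<sigma>\<^sup>2 / 2 - r)" for c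
    using prob_rtr_exp_ge[OF fin indep sa sq var] by (auto simp: E_def S_def EY_def)
  have Y_meas: "Y i \<in> borel_measurable M" if "i \<in> I" for i
    using indep that by (auto simp: indep_vars_def)
  have int: "integrable M (Y i)" if "i \<in> I" for i
    using integrable_matrix_of_square_integrable[OF Y_meas[OF that] sq[OF that]] by auto
  have EY: "self_adjoint EY"
    unfolding EY_def using int sa
    by (intro self_adjoint_sum) (simp add: mat_expectation_eq_integral self_adjoint_integral)
  \<comment> \<open>At a unit vector attaining the norm, the quadratic form of
    \<open>D \<omega>\<close> is at least \<open>r\<close> or at most \<open>- r\<close>. The two
    cases are covered by \<open>E \<theta>\<close> and \<open>E (- \<theta>)\<close>.\<close>
  have "\<omega> \<in> E \<theta> \<union> E (- \<theta>)" if \<omega>: "\<omega> \<in> space M" and ge: "r \<le> op_norm (D \<omega>)" for \<omega>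
  proof -
    have Y: "self_adjoint (Y i \<omega>)" if "i \<in> I" for i using sa that \<omega> by blast
    have D: "self_adjoint (D \<omega>)"
      unfolding D_def
      by (intro self_adjoint_diff self_adjoint_sum self_adjoint_mat_fun self_adjoint_scaleR EY Y)
    have S: "self_adjoint (S c \<omega>)" for c
      unfolding S_def
      by (intro self_adjoint_diff self_adjoint_sum self_adjoint_mat_fun self_adjoint_scaleR EY Y)
    have psd_sum: "psd (\<Sum>i\<in>I. P i)" if "\<And>i. i \<in> I \<Longrightarrow> psd (P i)" for P :: "'i \<Rightarrow> complex^'d^'d"
      unfolding psd_def
    proof
      fix x
      have "x \<bullet> ((\<Sum>i\<in>I. P i) *v x) = (\<Sum>i\<in>I. x \<bullet> (P i *v x))"
        by (rule linear_sum[OF bounded_linear.linear[OF bounded_linear_quadratic_form]])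
      thus "0 \<le> x \<bullet> ((\<Sum>i\<in>I. P i) *v x)" using that by (simp add: psd_def sum_nonneg)
    qed
    obtain x where x: "norm x = 1" "op_norm (D \<omega>) \<le> \<bar>x \<bullet> (D \<omega> *v x)\<bar>"
      using op_norm_witness[OF D] .
    have 1: "x \<bullet> (D \<omega> *v x) \<le> x \<bullet> (S \<theta> \<omega> *v x)"
    proof -
      have "psd (mat_fun (ln_quadratic \<theta>) (Y i \<omega>) - mat_fun \<psi> (\<theta> *\<^sub>R Y i \<omega>))" if "i \<in> I" for i
        unfolding mat_fun_scaleR[OF Y[OF that]] by (intro psd_mat_fun_diff Y that upper)
      from psd_sum[OF this]
      have "psd (S \<theta> \<omega> - D \<omega>)" by (simp add: S_def D_def sum_subtractf)
      hence "0 \<le> x \<bullet> ((S \<theta> \<omega> - D \<omega>) *v x)" by (simp add: psd_def)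
      thus ?thesis by (simp add: matrix_vector_mult_diff_rdistrib inner_diff_right)
    qed
    have 2: "- (x \<bullet> (D \<omega> *v x)) \<le> x \<bullet> (S (- \<theta>) \<omega> *v x)"
    proof -
      have "psd (mat_fun (ln_quadratic (- \<theta>)) (Y i \<omega>) + mat_fun \<psi> (\<theta> *\<^sub>R Y i \<omega>))" if i: "i \<in> I" for i
      proof -
        have "mat_fun (\<lambda>x. - 1 * \<psi> (\<theta> * x)) (Y i \<omega>) = - mat_fun \<psi> (\<theta> *\<^sub>R Y i \<omega>)"
          unfolding mat_fun_mult[OF Y[OF i]] mat_fun_const[OF Y[OF i]] mat_fun_scaleR[OF Y[OF i]]
          by (simp only: matrix_mult_scaleR_left matrix_mul_lid) simp
        moreover have "- 1 * \<psi> (\<theta> * x) \<le> ln_quadratic (- \<theta>) x" for x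
          using lower[of "\<theta> * x"] by simp
        ultimately show ?thesis
          using psd_mat_fun_diff[OF Y[OF i], of "\<lambda>x. - 1 * \<psi> (\<theta> * x)" "ln_quadratic (- \<theta>)"] by simp
      qed
      from psd_sum[OF this]
      have "psd (S (- \<theta>) \<omega> + D \<omega>)" by (simp add: S_def D_def sum.distrib)
      hence "0 \<le> x \<bullet> ((S (- \<theta>) \<omega> + D \<omega>) *v x)" by (simp add: psd_def)
      thus ?thesis by (simp add: matrix_vector_mult_add_rdistrib inner_add_right)
    qed
    have "r \<le> x \<bullet> (S \<theta> \<omega> *v x) \<or> r \<le> x \<bullet> (S (- \<theta>) \<omega> *v x)"
      using 1 2 x(2) ge by linarith
    thus ?thesis
      using exp_le_rtr_exp[OF S x(1)] \<omega> by (auto simp: E_def)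
  qed
  moreover have "prob (E \<theta> \<union> E (- \<theta>)) \<le> 2 * real CARD('d) * exp (\<theta>\<^sup>2 * \<sigma>\<^sup>2 / 2 - r)"
    using measure_Un_le[OF E(1)[of \<theta>] E(1)[of "- \<theta>"]] E(2)[of \<theta>] E(2)[of "- \<theta>"] by simp
  ultimately show ?thesis
    using that[of "E \<theta> \<union> E (- \<theta>)"] E(1) by (auto simp: D_def EY_def)
qed

end

section \<open>Lepski's method\<close>

text \<open>Bernoulli's inequality \<open>1 + i \<le> 2 ^ i\<close> at \<open>i = k - m\<close>
  bounds each term by a power of \<open>exp (- t)\<close>. The exponents are distinct and start at
  one, which accounts for the numerator.\<close>

lemma sum_exp_dyadic_le:
  fixes s t :: real and m :: int
  assumes t: "0 < t" "t \<le> 2 powr real_of_int m * s" and K: "finite K" "\<And>k. k \<in> K \<Longrightarrow> m \<le> k"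
  shows "(\<Sum>k\<in>K. exp (- (2 powr real_of_int k * s))) \<le> exp (- t) / (1 - exp (- t))"
proof -
  let ?q = "exp (- t)"
  have q: "0 < ?q" "?q < 1" using t by auto
  have sums: "(\<lambda>i. ?q * ?q ^ i) sums (?q * (1 / (1 - ?q)))"
    using q by (intro sums_mult geometric_sums) simp
  have le: "exp (- (2 powr real_of_int k * s)) \<le> ?q * ?q ^ nat (k - m)" if "k \<in> K" for k
  proof -
    define i where "i = nat (k - m)"
    have k: "real_of_int k = real i + real_of_int m" using K(2)[OF that] by (simp add: i_def)
    have "(1 + real i) * t \<le> 2 ^ i * t"
      using Bernoulli_inequality[of 1 i] t by (intro mult_right_mono) auto
    also have "\<dots> \<le> 2 ^ i * (2 powr real_of_int m * s)" using t by (intro mult_left_mono) auto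
    also have "\<dots> = 2 powr real_of_int k * s" by (simp add: k powr_add powr_realpow)
    finally have "exp (- (2 powr real_of_int k * s)) \<le> exp (- ((1 + real i) * t))" by simp
    also have "\<dots> = ?q * ?q ^ i"
      by (simp add: exp_of_nat_mult[symmetric] exp_add[symmetric] algebra_simps)
    finally show ?thesis by (simp add: i_def)
  qed
  have inj: "inj_on (\<lambda>k. nat (k - m)) K"
  proof (rule inj_onI)
    fix x y assume "x \<in> K" "y \<in> K" "nat (x - m) = nat (y - m)"
    with K(2)[of x] K(2)[of y] show "x = y" by simp
  qed
  have "(\<Sum>k\<in>K. exp (- (2 powr real_of_int k * s))) \<le> (\<Sum>k\<in>K. ?q * ?q ^ nat (k - m))"
    by (intro sum_mono le)
  also have "\<dots> = (\<Sum>i\<in>(\<lambda>k. nat (k - m)) ` K. ?q * ?q ^ i)"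
    by (simp add: sum.reindex[OF inj])
  also have "\<dots> \<le> (\<Sum>i. ?q * ?q ^ i)"
    using sums K(1) q by (intro sum_le_suminf) (auto simp: sums_iff)
  also have "\<dots> = ?q / (1 - ?q)" using sums by (simp add: sums_iff)
  finally show ?thesis .
qed

text \<open>A member satisfies \<open>0 < j\<close> and \<open>j \<le> 2 ^ j < b / a\<close>.
  Finiteness is what gives \<open>Min\<close> its meaning in the selection rule.\<close>

lemma dyadic_grid_finite:
  fixes a b :: real
  assumes "0 < a"
  shows "finite {j::int. a < 2 powr real_of_int j * a \<and> 2 powr real_of_int j * a < b}"
proof (rule finite_subset)
  show "{j::int. a < 2 powr real_of_int j * a \<and> 2 powr real_of_int j * a < b} \<subseteq> {0..\<lceil>b / a\<rceil>}"
  proof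
    fix j :: int
    assume "j \<in> {j. a < 2 powr real_of_int j * a \<and> 2 powr real_of_int j * a < b}"
    hence j: "a < 2 powr real_of_int j * a" "2 powr real_of_int j * a < b" by auto
    have "1 < 2 powr real_of_int j" using j(1) assms by simp
    hence "real_of_int j > 0" using powr_less_cancel_iff[of 2 0 "real_of_int j"] by simp
    hence j0: "j > 0" by simp
    have "real_of_int j \<le> 2 powr real_of_int j"
    proof -
      have "real_of_int j = real (nat j)" using j0 by simp
      also have "\<dots> \<le> 2 ^ nat j" by (rule less_imp_le[OF of_nat_less_two_power])
      also have "\<dots> = 2 powr real_of_int j" using j0 by (simp add: powr_realpow[symmetric])
      finally show ?thesis .
    qed
    also have "\<dots> < b / a" using j(2) assms by (simp add: field_simps)
    finally have "j \<le> \<lceil>b / a\<rceil>" by linarith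
    thus "j \<in> {0..\<lceil>b / a\<rceil>}" using j0 by simp
  qed
qed simp

lemma dyadic_grid_point:
  fixes a b t :: real
  assumes a: "0 < a" "a < b" and t: "a \<le> t" "t \<le> b"
  obtains m :: int where "a < 2 powr real_of_int m * a" "2 powr real_of_int m * a < 2 * b"
    "t \<le> 2 powr real_of_int m * a" "2 powr real_of_int m * a \<le> 2 * t"
proof (cases "t = a")
  case True
  \<comment> \<open>The grid excludes its left endpoint, so \<open>t = a\<close> is rounded up to
    \<open>2 * a\<close>, still at most \<open>2 * t\<close>.\<close>
  thus ?thesis using a by (intro that[of 1]) auto
next
  case False
  define m where "m = \<lceil>log 2 (t / a)\<rceil>"
  have ta: "t / a > 1" using False a t by (simp add: field_simps)
  have "t / a = 2 powr log 2 (t / a)" using ta by (simp add: powr_log_cancel)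
  also have "\<dots> \<le> 2 powr real_of_int m" by (intro powr_mono) (auto simp: m_def)
  finally have 1: "t \<le> 2 powr real_of_int m * a" using a by (simp add: field_simps)
  have "2 powr (real_of_int m - 1) < 2 powr log 2 (t / a)"
    by (intro powr_less_mono) (auto simp: m_def, linarith)
  also have "\<dots> = t / a" using ta by (simp add: powr_log_cancel)
  finally have 2: "2 powr real_of_int m * a < 2 * t" using a by (simp add: powr_diff field_simps)
  have 3: "a < 2 powr real_of_int m * a" using 1 False t by linarith
  show ?thesis by (rule that[OF 3 _ 1]) (use 2 t in linarith)+
qed

theorem theoremC1:
  fixes M :: "'a measure"
    and Y :: "nat \<Rightarrow> 'a \<Rightarrow> complex^'d^'d"
    and \<psi> :: "real \<Rightarrow> real"
    and n :: nat and \<sigma> tmin tmax t :: real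
  assumes "prob_space M"
    and "mono \<psi>"
    and "\<And>x. - ln (1 - x + x^2/2) \<le> \<psi> x"
    and "\<And>x. \<psi> x \<le> ln (1 + x + x^2/2)"
    and "n \<ge> 1"
    and "prob_space.indep_vars M (\<lambda>_. borel) Y {1..n}"
    and "\<And>i \<omega>. i \<in> {1..n} \<Longrightarrow> \<omega> \<in> space M \<Longrightarrow> self_adjoint (Y i \<omega>)"
    and "\<And>i a b. i \<in> {1..n} \<Longrightarrow> integrable M (\<lambda>\<omega>. (norm (Y i \<omega> $ a $ b))^2)"
    and "\<sigma> > 0"
    and "\<sigma>^2 \<ge> op_norm (\<Sum>i=1..n. mat_expectation M (\<lambda>\<omega>. Y i \<omega> ** Y i \<omega>))"
    and "0 < tmin" and "tmin < tmax"
    and "tmin \<le> t" and "t \<le> tmax"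
  shows "let EYbar = (1 / real n) *\<^sub>R (\<Sum>i=1..n. mat_expectation M (Y i));
             tj = (\<lambda>j::int. 2 powr (real_of_int j) * tmin);
             J = {j::int. tmin < tj j \<and> tj j < 2 * tmax};
             \<theta> = (\<lambda>j. sqrt (2 * tj j / real n) * sqrt (real n) / \<sigma>);
             T = (\<lambda>j \<omega>. (1 / (real n * \<theta> j)) *\<^sub>R (\<Sum>i=1..n. mat_fun \<psi> (\<theta> j *\<^sub>R Y i \<omega>)));
             jstar = (\<lambda>\<omega>. Min {j \<in> J. \<forall>k \<in> J. k > j \<longrightarrow>
                        op_norm (T k \<omega> - T j \<omega>) \<le> 2 * (\<sigma> / sqrt (real n)) * sqrt (2 * tj k / real n)});
             Tstar = (\<lambda>\<omega>. T (jstar \<omega>) \<omega>)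
         in measure M {\<omega> \<in> space M. op_norm (Tstar \<omega> - EYbar) \<ge> 6 * (\<sigma> / sqrt (real n)) * sqrt (t / real n)}
            \<le> 2 * real CARD('d) * exp (- t) / (1 - exp (- t))"
proof -
  interpret prob_space M by fact
  define EYbar where "EYbar = (1 / real n) *\<^sub>R (\<Sum>i=1..n. mat_expectation M (Y i))"
  define tj where "tj = (\<lambda>j::int. 2 powr (real_of_int j) * tmin)"
  define J where "J = {j::int. tmin < tj j \<and> tj j < 2 * tmax}"
  define \<theta> where "\<theta> = (\<lambda>j. sqrt (2 * tj j / real n) * sqrt (real n) / \<sigma>)"
  define T where "T = (\<lambda>j \<omega>. (1 / (real n * \<theta> j)) *\<^sub>R (\<Sum>i=1..n. mat_fun \<psi> (\<theta> j *\<^sub>R Y i \<omega>)))"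
  define \<tau> where "\<tau> j = (\<sigma> / sqrt (real n)) * sqrt (2 * tj j / real n)" for j
  define A where "A \<omega> = {j \<in> J. \<forall>k \<in> J. k > j \<longrightarrow> op_norm (T k \<omega> - T j \<omega>) \<le> 2 * \<tau> k}" for \<omega>
  define Bad where "Bad = {\<omega> \<in> space M. op_norm (T (Min (A \<omega>)) \<omega> - EYbar) \<ge> 6 * (\<sigma> / sqrt (real n)) * sqrt (t / real n)}"
  have n: "real n > 0" using \<open>n \<ge> 1\<close> by simp
  note \<sigma> = \<open>\<sigma> > 0\<close>
  have tj_pos: "tj j > 0" for j using \<open>0 < tmin\<close> by (simp add: tj_def)
  have tj_mono: "tj j \<le> tj k" if "j \<le> k" for j k
    using that \<open>0 < tmin\<close> by (simp add: tj_def)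
  have \<tau>_mono: "\<tau> j \<le> \<tau> k" if "j \<le> k" for j k
    unfolding \<tau>_def using tj_mono[OF that] \<sigma> by (intro mult_left_mono real_sqrt_le_mono divide_right_mono) auto
  have finJ: "finite J" unfolding J_def tj_def by (rule dyadic_grid_finite) fact
  obtain m where m: "m \<in> J" "t \<le> tj m" "tj m \<le> 2 * t"
    using dyadic_grid_point[of tmin tmax t] assms unfolding J_def tj_def by (metis (lifting) mem_Collect_eq)
  have "\<exists>E. E \<in> sets M \<and> prob E \<le> 2 * real CARD('d) * exp (- tj j) \<and>
      {\<omega> \<in> space M. \<tau> j \<le> op_norm (T j \<omega> - EYbar)} \<subseteq> E" for j
  proof -
    have \<theta>: "\<theta> j = sqrt (2 * tj j) / \<sigma>"
      using n by (simp add: \<theta>_def real_sqrt_divide)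
    have \<theta>_pos: "\<theta> j > 0" using tj_pos[of j] \<sigma> by (simp add: \<theta>)
    \<comment> \<open>The deviation level is chosen as \<open>2 * tj j\<close>. The variance term
      then equals \<open>tj j\<close>, leaving the exponent \<open>- tj j\<close>, and dividing the
      level by the scale \<open>n * \<theta> j\<close> gives exactly
      \<open>\<tau> j\<close>.\<close>
    have exponent: "(\<theta> j)\<^sup>2 * \<sigma>\<^sup>2 / 2 - 2 * tj j = - tj j"
      using tj_pos[of j] \<sigma> by (simp add: \<theta> power_divide)
    have scale: "real n * \<theta> j * \<tau> j = 2 * tj j"
      using n \<sigma> tj_pos[of j] by (simp add: \<theta> \<tau>_def real_sqrt_divide)
    have eq: "(\<Sum>i=1..n. mat_fun \<psi> (\<theta> j *\<^sub>R Y i \<omega>)) - \<theta> j *\<^sub>R (\<Sum>i=1..n. mat_expectation M (Y i))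
        = (real n * \<theta> j) *\<^sub>R (T j \<omega> - EYbar)" for \<omega>
      using n \<theta>_pos by (simp add: T_def EYbar_def scaleR_diff_right)
    have iff: "\<tau> j \<le> op_norm (T j \<omega> - EYbar) \<longleftrightarrow> 2 * tj j \<le> op_norm ((real n * \<theta> j) *\<^sub>R (T j \<omega> - EYbar))" for \<omega>
      unfolding scale[symmetric] op_norm_scaleR using n \<theta>_pos by simp
    obtain E where "E \<in> sets M" "prob E \<le> 2 * real CARD('d) * exp ((\<theta> j)\<^sup>2 * \<sigma>\<^sup>2 / 2 - 2 * tj j)"
      "{\<omega> \<in> space M. 2 * tj j \<le> op_norm ((\<Sum>i=1..n. mat_fun \<psi> (\<theta> j *\<^sub>R Y i \<omega>)) - \<theta> j *\<^sub>R (\<Sum>i=1..n. mat_expectation M (Y i)))} \<subseteq> E"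
      by (rule truncated_mean_deviation[OF finite_atLeastAtMost assms(6) assms(7) assms(8) assms(10) assms(3) assms(4)])
    thus ?thesis unfolding eq exponent iff by blast
  qed
  then obtain E where E: "\<And>j. E j \<in> sets M" "\<And>j. prob (E j) \<le> 2 * real CARD('d) * exp (- tj j)"
    "\<And>j \<omega>. \<omega> \<in> space M \<Longrightarrow> \<tau> j \<le> op_norm (T j \<omega> - EYbar) \<Longrightarrow> \<omega> \<in> E j"
    by (metis (lifting) mem_Collect_eq subsetD)
  define K where "K = {k \<in> J. m \<le> k}"
  have finK: "finite K" using finJ by (simp add: K_def)
  have sub: "Bad \<subseteq> (\<Union>k\<in>K. E k)"
  proof (rule subsetI, rule ccontr)
    fix \<omega> assume bad: "\<omega> \<in> Bad" and "\<omega> \<notin> (\<Union>k\<in>K. E k)"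
    hence close: "op_norm (T k \<omega> - EYbar) < \<tau> k" if "k \<in> J" "m \<le> k" for k
      using that E(3)[of \<omega> k] by (force simp: K_def Bad_def)
    have "m \<in> A \<omega>"
      unfolding A_def
    proof (safe intro!: m(1))
      fix k assume k: "k \<in> J" "m < k"
      have "op_norm (T k \<omega> - T m \<omega>) \<le> op_norm (T k \<omega> - EYbar) + op_norm (T m \<omega> - EYbar)"
        using op_norm_diff_triangle[of "T k \<omega>" "T m \<omega>" EYbar] by (simp add: op_norm_diff_commute[of EYbar])
      thus "op_norm (T k \<omega> - T m \<omega>) \<le> 2 * \<tau> k"
        using close[OF k(1)] close[OF m(1)] k \<tau>_mono[of m k] by simp
    qed
    moreover have finA: "finite (A \<omega>)" using finJ by (simp add: A_def)
    ultimately have js: "Min (A \<omega>) \<in> A \<omega>" "Min (A \<omega>) \<le> m" by (auto intro: Min_in)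
    \<comment> \<open>The selection rule compares an index only with strictly larger ones, so
      equality with \<open>m\<close> is treated separately.\<close>
    have "op_norm (T m \<omega> - T (Min (A \<omega>)) \<omega>) \<le> 2 * \<tau> m"
    proof (cases "Min (A \<omega>) = m")
      case True
      have "0 \<le> \<tau> m" using \<sigma> n tj_pos[of m] by (simp add: \<tau>_def)
      thus ?thesis using op_norm_scaleR[of 0 "0 :: complex^'d^'d"] by (simp add: True)
    next
      case False
      thus ?thesis using js m(1) by (auto simp: A_def)
    qed
    hence "op_norm (T (Min (A \<omega>)) \<omega> - EYbar) < 3 * \<tau> m"
      using op_norm_diff_triangle[of "T (Min (A \<omega>)) \<omega>" EYbar "T m \<omega>"] close[OF m(1)]
      by (simp add: op_norm_diff_commute[of "T m \<omega>"])
    \<comment> \<open>Rounding \<open>t\<close> up to the grid costs at most a factor 2, so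
      \<open>2 * tj m \<le> 4 * t\<close>; the square root doubles the constant 3.\<close>
    also have "3 * \<tau> m \<le> 6 * (\<sigma> / sqrt (real n)) * sqrt (t / real n)"
    proof -
      have "sqrt (2 * tj m / real n) \<le> sqrt (4 * (t / real n))"
        using m(3) n by (intro real_sqrt_le_mono) (simp add: field_simps)
      also have "\<dots> = 2 * sqrt (t / real n)" by (simp only: real_sqrt_mult real_sqrt_four)
      finally have "(\<sigma> / sqrt (real n)) * sqrt (2 * tj m / real n) \<le> (\<sigma> / sqrt (real n)) * (2 * sqrt (t / real n))"
        using \<sigma> by (intro mult_left_mono) auto
      thus ?thesis by (simp add: \<tau>_def)
    qed
    finally show False using bad by (simp add: Bad_def)
  qed
  have t_pos: "t > 0" using assms by linarith
  have sum_le: "(\<Sum>k\<in>K. exp (- tj k)) \<le> exp (- t) / (1 - exp (- t))"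
    unfolding tj_def by (rule sum_exp_dyadic_le[of t m]) (use t_pos m(2) finK in \<open>auto simp: K_def tj_def\<close>)
  have "measure M Bad \<le> measure M (\<Union>k\<in>K. E k)"
    \<comment> \<open>\<open>Bad\<close> may fail to be measurable; \<open>measure\<close> is then
      zero and the bound is trivial.\<close>
    using sub finK E(1) by (cases "Bad \<in> sets M") (auto intro!: finite_measure_mono simp: measure_notin_sets)
  also have "\<dots> \<le> (\<Sum>k\<in>K. prob (E k))"
    using E(1) finK by (intro finite_measure_subadditive_finite) auto
  also have "\<dots> \<le> (\<Sum>k\<in>K. 2 * real CARD('d) * exp (- tj k))" by (intro sum_mono E(2))
  also have "\<dots> \<le> 2 * real CARD('d) * (exp (- t) / (1 - exp (- t)))"
    unfolding sum_distrib_left[symmetric] by (intro mult_left_mono sum_le) simp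
  finally have "measure M Bad \<le> 2 * real CARD('d) * exp (- t) / (1 - exp (- t))" by simp
  thus ?thesis
    unfolding Let_def Bad_def A_def J_def T_def \<theta>_def tj_def EYbar_def \<tau>_def
    by (simp only: mult.assoc)
qed

end
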